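(* There is an exact sequence $$0\longrightarrow W_2(\mathcal C)\longrightarrow \mathrm{Sel}_2(\mathcal C)\xrightarrow{\ \mathrm{cl}\ }\mathrm{Cl}^+(k)^2[2]\longrightarrow 0,$$ where the first map is inclusion and $\mathrm{cl}$ sends $a\mathbb Q^{\times2}$ (with $a$ a positive squarefree divisor of $\Delta$) to the narrow ideal class of the ambiguous ideal $\mathfrak a$ of $\mathcal O_k$ with norm $a$. In particular $\text{Ш}_2(\mathcal C)\simeq \mathrm{Cl}^+(k)^2[2]$.
   Context: Let $d$ be a squarefree integer with $d\neq 1$, and put $\Delta=d$ if $d\equiv 1\pmod 4$ and $\Delta=4d$ if $d\equiv 2,3\pmod 4$; let $k=\mathbb Q(\sqrt\Delta)$, the quadratic field of discriminant $\Delta$, with ring of integers $\mathcal O_k$, and let $\mathrm{Cl}^+(k)$ be its narrow ideal class group; for an abelian group $G$, $G^2=\{g^2\}$ and $G^2[2]$ is the set of elements of $G^2$ of order dividing $2$. For a positive squarefree divisor $a$ of $\Delta$, put $b=\Delta/a$ and let $\mathcal T_a$ be the curve $ar^2-bs^2=4$; the ambiguous ideal of norm $a$ is the unique ideal $\mathfrak a$ of $\mathcal O_k$ equal to its conjugate and of norm $a$ (the product of the ramified primes over the primes dividing $a$). The $2$-Selmer group $\mathrm{Sel}_2(\mathcal C)$ is the subgroup of $\mathbb Q^\times/\mathbb Q^{\times2}$ consisting of the classes $a\mathbb Q^{\times2}$, $a$ a positive squarefree divisor of $\Delta$, such that $\mathcal T_a$ has a rational point; $W_2(\mathcal C)$ is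 its subgroup of those classes for which $\mathcal T_a$ has an integral point; and $\text{Ш}_2(\mathcal C)=\mathrm{Sel}_2(\mathcal C)/W_2(\mathcal C)$. *)

theory Defs
  imports
    Complex_Main
    "HOL-Computational_Algebra.Polynomial"
    "HOL-Computational_Algebra.Squarefree"
    "HOL-Algebra.Algebra"
begin

section \<open>Group-theoretic notions\<close>

definition squares_2torsion :: "('a, 'b) monoid_scheme \<Rightarrow> 'a set" where
  "squares_2torsion G =
     {x \<in> (\<lambda>g. g \<otimes>\<^bsub>G\<^esub> g) ` carrier G. x \<otimes>\<^bsub>G\<^esub> x = \<one>\<^bsub>G\<^esub>}"

text \<open>The library constant \<open>short_exact_sequence\<close> forces all groups to have elements of
  the same type, hence this heterogeneous version.\<close>

definition short_exact ::
    "('a, 'm) monoid_scheme \<Rightarrow> ('b, 'n) monoid_scheme \<Rightarrow> ('c, 'k) monoid_scheme \<Rightarrow>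
     ('a \<Rightarrow> 'b) \<Rightarrow> ('b \<Rightarrow> 'c) \<Rightarrow> bool" where
  "short_exact A B C f g \<longleftrightarrow>
     group A \<and> group B \<and> group C \<and>
     f \<in> mon A B \<and> g \<in> epi B C \<and> f ` carrier A = kernel B C g"


section \<open>Quadratic fields and their narrow class groups\<close>

definition quad_disc :: "int \<Rightarrow> int" where
  "quad_disc d = (if d mod 4 = 1 then d else 4 * d)"

definition ring_on :: "'a::ring_1 set \<Rightarrow> 'a ring" where
  "ring_on S = \<lparr>carrier = S, mult = (*), one = 1, ring.zero = 0, add = (+)\<rparr>"

definition quad_field :: "int \<Rightarrow> complex set" where
  "quad_field D = {p + q * csqrt (of_int D) | p q. p \<in> \<rat> \<and> q \<in> \<rat>}"

definition quad_ints :: "int \<Rightarrow> complex set" where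
  "quad_ints D = {x \<in> quad_field D. algebraic_int x}"

text \<open>The image of \<open>S \<subseteq> \<rat>(\<surd>D)\<close> under the nontrivial automorphism; this is not
  complex conjugation when \<open>D > 0\<close>.\<close>

definition quad_conj :: "int \<Rightarrow> complex set \<Rightarrow> complex set" where
  "quad_conj D S =
     {p - q * csqrt (of_int D) | p q. p \<in> \<rat> \<and> q \<in> \<rat> \<and> p + q * csqrt (of_int D) \<in> S}"

text \<open>If \<open>D < 0\<close> there are no real embeddings, and every nonzero element is totally positive.\<close>

definition totally_positive :: "int \<Rightarrow> complex \<Rightarrow> bool" where
  "totally_positive D x \<longleftrightarrow> x \<in> quad_field D \<and> x \<noteq> 0 \<and>
     (\<forall>\<sigma> \<in> ring_hom (ring_on (quad_field D)) (ring_on (UNIV :: real set)). \<sigma> x > 0)"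

definition fractional_ideal :: "int \<Rightarrow> complex set \<Rightarrow> bool" where
  "fractional_ideal D J \<longleftrightarrow>
     J \<subseteq> quad_field D \<and> 0 \<in> J \<and> J \<noteq> {0} \<and>
     (\<forall>x\<in>J. \<forall>y\<in>J. x + y \<in> J) \<and>
     (\<forall>c\<in>quad_ints D. \<forall>x\<in>J. c * x \<in> J) \<and>
     (\<exists>c\<in>quad_ints D. c \<noteq> 0 \<and> (\<forall>x\<in>J. c * x \<in> quad_ints D))"

definition ideal_group :: "int \<Rightarrow> complex set monoid" where
  "ideal_group D =
     \<lparr>carrier = {J. fractional_ideal D J},
      mult = ideal_prod (ring_on (quad_field D)),
      one = quad_ints D\<rparr>"

definition narrow_principal :: "int \<Rightarrow> complex set set" where
  "narrow_principal D = {(\<lambda>y. x * y) ` quad_ints D | x. totally_positive D x}"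

definition narrow_class_group :: "int \<Rightarrow> complex set set monoid" where
  "narrow_class_group D = ideal_group D Mod narrow_principal D"

definition narrow_class :: "int \<Rightarrow> complex set \<Rightarrow> complex set set" where
  "narrow_class D J = narrow_principal D #>\<^bsub>ideal_group D\<^esub> J"

definition Cl2_2 :: "int \<Rightarrow> complex set set monoid" where
  "Cl2_2 D = (narrow_class_group D)\<lparr>carrier := squares_2torsion (narrow_class_group D)\<rparr>"

definition ambiguous_ideal :: "int \<Rightarrow> nat \<Rightarrow> complex set" where
  "ambiguous_ideal D a =
     (THE I. ideal I (ring_on (quad_ints D)) \<and> quad_conj D I = I \<and>
             Coset.order (ring_on (quad_ints D) Quot I) = a)"


section \<open>The 2-Selmer and Tate--Shafarevich groups of the Pell conic\<close>

definition rat_units :: "rat monoid" where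
  "rat_units = \<lparr>carrier = - {0}, mult = (*), one = 1\<rparr>"

definition rat_unit_squares :: "rat set" where
  "rat_unit_squares = {x ^ 2 | x. x \<noteq> 0}"

definition square_class :: "nat \<Rightarrow> rat set" where
  "square_class a = rat_unit_squares #>\<^bsub>rat_units\<^esub> of_nat a"

definition sqfree_divisor :: "int \<Rightarrow> nat \<Rightarrow> bool" where
  "sqfree_divisor D a \<longleftrightarrow> a > 0 \<and> squarefree a \<and> int a dvd D"

text \<open>The points of \<open>a r\<^sup>2 - b s\<^sup>2 = 4\<close>, \<open>b = D / a\<close>, with coordinates in
  the ring \<open>'a\<close>.\<close>

definition torsor :: "int \<Rightarrow> nat \<Rightarrow> ('a::comm_ring_1 \<times> 'a) set" where
  "torsor D a = {(r, s). of_nat a * r ^ 2 - of_int (D div int a) * s ^ 2 = 4}"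

definition Sel2_set :: "int \<Rightarrow> rat set set" where
  "Sel2_set D = {square_class a | a. sqfree_divisor D a \<and> (torsor D a :: (rat \<times> rat) set) \<noteq> {}}"

definition W2_set :: "int \<Rightarrow> rat set set" where
  "W2_set D = {square_class a | a. sqfree_divisor D a \<and> (torsor D a :: (int \<times> int) set) \<noteq> {}}"

definition Sel2 :: "int \<Rightarrow> rat set monoid" where
  "Sel2 D = (rat_units Mod rat_unit_squares)\<lparr>carrier := Sel2_set D\<rparr>"

definition W2 :: "int \<Rightarrow> rat set monoid" where
  "W2 D = (Sel2 D)\<lparr>carrier := W2_set D\<rparr>"

definition Sha2 :: "int \<Rightarrow> rat set set monoid" where
  "Sha2 D = Sel2 D Mod W2_set D"

end

theory Submission
  imports Defs
begin

text \<open>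
  A rational point of \<open>a r\<^sup>2 - b s\<^sup>2 = 4\<close> is the same as an element \<open>(a r + s \<surd>\<Delta>) / 2\<close> of norm \<open>a\<close>, and an
  integral point is the same as a generator of norm \<open>a\<close> of the ambiguous ideal \<open>\<aa>\<close>; since \<open>a > 0\<close>, such a
  generator is totally positive up to sign. This identifies the kernel of \<open>cl\<close>.

  If \<open>a\<close> is the norm of a totally positive \<open>\<alpha>\<close>, then \<open>J = \<aa> / \<alpha>\<close> has norm \<open>1\<close>, and \<open>\<bb> = \<O> + J\<close> satisfies
  \<open>J \<bb>' = \<bb>\<close>. Hence \<open>J = \<bb>\<^sup>2 / N\<bb>\<close>, and the class of \<open>\<aa>\<close> is a square; it is 2-torsion because \<open>\<aa>\<^sup>2 = (a)\<close>.

  Conversely, a class which is the square of the class of \<open>\<bb>\<close> is represented by \<open>J = \<bb>\<^sup>2 / N\<bb>\<close>, of norm \<open>1\<close>. If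
  \<open>J\<^sup>2 = (\<gamma>)\<close> with \<open>\<gamma>\<close> totally positive, then \<open>\<gamma>\<close> has norm \<open>1\<close> and equals \<open>\<delta>\<^sup>2 / N\<delta>\<close> with \<open>\<delta>\<close> totally
  positive. The ideal \<open>J / \<delta>\<close> is then stable under conjugation, hence a rational multiple of an ambiguous
  ideal of squarefree norm \<open>a\<close> dividing \<open>\<Delta>\<close>, and comparing norms shows that \<open>a\<close> is a norm.
\<close>

section \<open>Rational numbers with bounded denominators and squarefree integers\<close>

text \<open>The ideal theory rests on \<open>imul_cj_principal\<close>: the product of a fractional
  ideal with its conjugate is generated by a positive rational number. This yields inverses in the
  ideal group, and the positive generator, unique by \<open>principal_of_rat_inject\<close>, serves
  as the norm of the ideal; "comparing norms" means comparing such generators.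

  The ideals \<aa> are handled through the divisibility condition defining \<open>ambig a\<close>.
  That \<aa>^2 = (a), and that a stable ideal scaled to have \<omega>-coordinate 1 has squarefree
  norm, both come from \<open>fundamental_discriminant\<close>, applied to the trace and norm of a
  single basis element \<open>t + \<omega>\<close>: a common factor \<open>h\<close> would be the
  index of the order of discriminant \<open>D\<close> in a larger one.

  Narrowness costs little. Every rational factor split off an ideal is positive, hence totally
  positive, so rescaling preserves narrow classes. By \<open>totally_positive_iff\<close> the real
  and imaginary cases share nearly all arguments, with positivity of norm and trace demanded only
  for \<open>D > 0\<close>.\<close>

lemma Ints_if_bounded_power_denominators:
  fixes r :: rat and m :: int
  assumes "m > 0" and bd: "\<And>k. of_int m * r ^ k \<in> \<int>"
  shows "r \<in> \<int>"
proof -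
  obtain p q where pq: "quotient_of r = (p, q)" by fastforce
  have q0: "q > 0" and cop: "coprime p q" and r: "r = of_int p / of_int q"
    using quotient_of_denom_pos[OF pq] quotient_of_coprime[OF pq] quotient_of_div[OF pq] by auto
  \<comment> \<open>Coprimality with \<open>p\<close> forces every \<open>q ^ k\<close> to divide
    \<open>m\<close>. The exponent \<open>m\<close> then rules out \<open>q \<ge> 2\<close>, because
    \<open>2 ^ m > m\<close>.\<close>
  have le: "q ^ k \<le> m" for k
  proof -
    from bd[of k] obtain z where z: "of_int m * r ^ k = of_int z" by (auto elim: Ints_cases)
    have "(of_int (m * p ^ k) :: rat) = of_int (z * q ^ k)"
      using z q0 by (simp add: r power_divide field_simps)
    hence "m * p ^ k = z * q ^ k" by (simp only: of_int_eq_iff)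
    hence "q ^ k dvd m * p ^ k" by simp
    moreover have "coprime (q ^ k) (p ^ k)"
      using cop by (simp add: coprime_commute)
    ultimately have "q ^ k dvd m" by (simp add: coprime_dvd_mult_left_iff)
    thus ?thesis using \<open>m > 0\<close> by (simp add: zdvd_imp_le)
  qed
  have "q = 1"
  proof (rule ccontr)
    assume "q \<noteq> 1"
    hence "q \<ge> 2" using q0 by simp
    hence "2 ^ nat m \<le> q ^ nat m" by (intro power_mono) auto
    hence "2 ^ nat m \<le> m" using le[of "nat m"] by linarith
    moreover have "int (nat m) < int (2 ^ nat m)" by (simp only: of_nat_less_iff less_exp)
    ultimately show False using \<open>m > 0\<close> by simp
  qed
  thus ?thesis using r by simp
qed

text \<open>Multiplication by \<open>c\<close> embeds \<open>S\<close> in the integers, so the least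
  positive element generates it by division with remainder. It is applied to the rational numbers in
  an ideal and to the \<omega>-coordinates of its elements.\<close>

lemma rat_subgroup_cyclic:
  fixes S :: "rat set" and c :: int
  assumes diff: "\<And>x y. x \<in> S \<Longrightarrow> y \<in> S \<Longrightarrow> x - y \<in> S"
    and "c > 0" and bd: "\<And>x. x \<in> S \<Longrightarrow> of_int c * x \<in> \<int>"
    and ne: "\<exists>x\<in>S. x \<noteq> 0"
  shows "\<exists>g>0. S = {of_int k * g | k. True}"
proof -
  have z: "0 \<in> S" using ne diff by fastforce
  have neg: "- x \<in> S" if "x \<in> S" for x using diff[OF z that] by simp
  have add: "x + y \<in> S" if "x \<in> S" "y \<in> S" for x y using diff[OF that(1) neg[OF that(2)]] by simp
  have mult_nat: "of_nat n * x \<in> S" if "x \<in> S" for n x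
    by (induction n) (auto simp: z add that algebra_simps)
  have mult: "of_int k * x \<in> S" if "x \<in> S" for k x
  proof (cases "k \<ge> 0")
    case True thus ?thesis using mult_nat[OF that, of "nat k"] by simp
  next
    case False thus ?thesis using neg[OF mult_nat[OF that, of "nat (- k)"]] by simp
  qed
  have rep: "\<exists>z. x = of_int z / of_int c" if "x \<in> S" for x
    using bd[OF that] \<open>c > 0\<close> by (auto elim!: Ints_cases simp: field_simps)
  define Q where "Q n \<longleftrightarrow> n > 0 \<and> of_nat n / of_int c \<in> S" for n :: nat
  have "\<exists>n. Q n"
  proof -
    obtain x where x: "x \<in> S" "x \<noteq> 0" using ne by auto
    define y where "y = \<bar>x\<bar>"
    have y: "y \<in> S" "y > 0" using x neg by (auto simp: y_def abs_if)
    obtain z where "y = of_int z / of_int c" using rep y by auto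
    thus ?thesis using y \<open>c > 0\<close> by (auto simp: Q_def zero_less_divide_iff intro!: exI[of _ "nat z"])
  qed
  define n where "n = (LEAST n. Q n)"
  have n: "Q n" unfolding n_def using \<open>\<exists>n. Q n\<close> by (rule LeastI_ex)
  have least: "n \<le> k" if "Q k" for k unfolding n_def by (rule Least_le[of Q, OF that])
  define g where "g = (of_nat n / of_int c :: rat)"
  have g: "g \<in> S" "g > 0" using n \<open>c > 0\<close> by (auto simp: Q_def g_def)
  have "S \<subseteq> {of_int k * g | k. True}"
  proof
    fix x assume x: "x \<in> S"
    then obtain z where z: "x = of_int z / of_int c" using rep by auto
    have "x - of_int (z div int n) * g \<in> S" using x g mult diff by blast
    also have "x - of_int (z div int n) * g = of_nat (nat (z mod int n)) / of_int c"
    proof -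
      have "z mod int n = z - z div int n * int n" by (simp add: minus_div_mult_eq_mod)
      moreover have "z mod int n \<ge> 0" using n by (simp add: Q_def)
      ultimately show ?thesis using \<open>c > 0\<close>
        by (simp add: z g_def diff_divide_distrib)
    qed
    finally have mem: "of_nat (nat (z mod int n)) / of_int c \<in> S" .
    have "nat (z mod int n) < n" using n by (simp add: Q_def nat_less_iff)
    hence "nat (z mod int n) = 0" using least[of "nat (z mod int n)"] mem
      unfolding Q_def by (metis bot_nat_0.not_eq_extremum leD)
    hence "z mod int n = 0" using n by (simp add: Q_def) (metis n nat_eq_iff2 Q_def of_nat_0_less_iff order_antisym pos_mod_sign)
    then obtain k where "z = int n * k" by auto
    thus "x \<in> {of_int k * g | k. True}" by (auto simp: z g_def)
  qed
  moreover have "{of_int k * g | k. True} \<subseteq> S" using mult g by auto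
  ultimately show ?thesis using g by blast
qed

text \<open>With \<open>a = g * a'\<close> and \<open>g = gcd a x\<close>, the cofactor
  \<open>a'\<close> is coprime to \<open>x div g\<close>, so it must divide \<open>g\<close>. Then
  \<open>a' ^ 2\<close> divides \<open>a\<close>, and \<open>a'\<close> is a unit.\<close>

lemma squarefree_dvd_square_imp_dvd:
  fixes a x :: int
  assumes "squarefree a" "a dvd x ^ 2"
  shows "a dvd x"
proof (rule ccontr)
  define g where "g = gcd a x"
  assume "\<not> a dvd x"
  have a0: "a \<noteq> 0" using assms by auto
  hence g0: "g \<noteq> 0" by (simp add: g_def)
  obtain a' x' where ax: "a = g * a'" "x = g * x'" by (metis g_def dvdE gcd_dvd1 gcd_dvd2)
  have cop: "coprime a' x'"
    using a0 ax g0 g_def by (metis coprime_iff_gcd_eq_1 gcd_mult_left abs_mult abs_gcd_int mult_cancel_left1 normalize_int_def mult.right_neutral mult_eq_0_iff abs_eq_0 mult_left_cancel)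
  have "a' dvd g * x' ^ 2"
    using assms(2) g0 by (simp add: ax power2_eq_square algebra_simps)
  moreover have "coprime a' (x' ^ 2)" using cop by simp
  ultimately have "a' dvd g" by (simp add: coprime_dvd_mult_left_iff)
  hence "a' ^ 2 dvd a" by (auto simp: ax power2_eq_square)
  hence "a' dvd 1" using assms(1) by (auto simp: squarefree_def)
  hence "a dvd g" unfolding ax by (metis dvd_refl mult_unit_dvd_iff)
  hence "a dvd x" unfolding ax(2) by (rule dvd_mult2)
  thus False using \<open>\<not> a dvd x\<close> by simp
qed

section \<open>Squares of order dividing 2 in an abelian group\<close>

lemma squares_2torsion_subgroup:
  fixes G (structure)
  assumes "comm_group G"
  shows "subgroup (squares_2torsion G) G"
proof -
  interpret comm_group G by (rule assms)
  show ?thesis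
  proof (rule subgroupI)
    show "squares_2torsion G \<subseteq> carrier G" by (auto simp: squares_2torsion_def)
    have "\<one> \<in> squares_2torsion G" unfolding squares_2torsion_def by (auto intro: image_eqI[of _ _ \<one>])
    thus "squares_2torsion G \<noteq> {}" by auto
  next
    fix x assume x: "x \<in> squares_2torsion G"
    hence "x \<in> carrier G" "x \<otimes> x = \<one>" by (auto simp: squares_2torsion_def)
    hence "inv x = x" by (simp add: inv_equality)
    thus "inv x \<in> squares_2torsion G" using x by simp
  next
    fix x y assume "x \<in> squares_2torsion G" "y \<in> squares_2torsion G"
    then obtain g h where gh: "g \<in> carrier G" "h \<in> carrier G" "x = g \<otimes> g" "y = h \<otimes> h"
        "x \<otimes> x = \<one>" "y \<otimes> y = \<one>"
      by (auto simp: squares_2torsion_def)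
    have xy: "x \<in> carrier G" "y \<in> carrier G" using gh by auto
    have "x \<otimes> y = (g \<otimes> h) \<otimes> (g \<otimes> h)" using gh by (simp add: m_ac)
    moreover have "(x \<otimes> y) \<otimes> (x \<otimes> y) = (x \<otimes> x) \<otimes> (y \<otimes> y)" using xy by (simp add: m_ac)
    ultimately show "x \<otimes> y \<in> squares_2torsion G"
      using gh xy unfolding squares_2torsion_def by (auto intro!: image_eqI[of _ _ "g \<otimes> h"])
  qed
qed

section \<open>Square classes\<close>

lemma rat_units_simps [simp]:
  "carrier rat_units = - {0}" "x \<otimes>\<^bsub>rat_units\<^esub> y = x * y" "\<one>\<^bsub>rat_units\<^esub> = 1"
  by (simp_all add: rat_units_def)

lemma comm_group_rat_units: "comm_group rat_units"
proof (rule comm_groupI)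
  show "\<exists>y\<in>carrier rat_units. y \<otimes>\<^bsub>rat_units\<^esub> x = \<one>\<^bsub>rat_units\<^esub>" if "x \<in> carrier rat_units" for x
    using that by (intro bexI[of _ "inverse x"]) auto
qed auto

interpretation rat_units: comm_group rat_units
  by (rule comm_group_rat_units)

lemma rat_unit_squares_subgroup: "subgroup rat_unit_squares rat_units"
proof (rule rat_units.subgroupI)
  show "rat_unit_squares \<subseteq> carrier rat_units" by (auto simp: rat_unit_squares_def)
  have "1 \<in> rat_unit_squares" unfolding rat_unit_squares_def by (auto intro!: exI[of _ 1])
  thus "rat_unit_squares \<noteq> {}" by auto
next
  fix x assume "x \<in> rat_unit_squares"
  then obtain y where y: "x = y ^ 2" "y \<noteq> 0" by (auto simp: rat_unit_squares_def)
  hence "inv\<^bsub>rat_units\<^esub> x = (inverse y) ^ 2"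
    by (intro rat_units.inv_equality) (auto simp: power2_eq_square field_simps)
  thus "inv\<^bsub>rat_units\<^esub> x \<in> rat_unit_squares" using y unfolding rat_unit_squares_def
    by (metis (mono_tags, lifting) inverse_nonzero_iff_nonzero mem_Collect_eq)
next
  fix x y assume "x \<in> rat_unit_squares" "y \<in> rat_unit_squares"
  then obtain u v where "x = u ^ 2" "u \<noteq> 0" "y = v ^ 2" "v \<noteq> 0" by (auto simp: rat_unit_squares_def)
  hence "x * y = (u * v) ^ 2" "u * v \<noteq> 0" by (auto simp: power_mult_distrib)
  thus "x \<otimes>\<^bsub>rat_units\<^esub> y \<in> rat_unit_squares" unfolding rat_unit_squares_def by auto
qed

interpretation rat_unit_squares: normal rat_unit_squares rat_units
  by (intro rat_units.subgroup_imp_normal rat_unit_squares_subgroup)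

abbreviation square_class_group :: "rat set monoid" where
  "square_class_group \<equiv> rat_units Mod rat_unit_squares"

lemma comm_group_square_classes: "comm_group square_class_group"
  by (rule rat_units.abelian_FactGroup[OF rat_unit_squares_subgroup])

lemma mem_square_class: "x \<in> square_class a \<longleftrightarrow> (\<exists>y. y \<noteq> 0 \<and> x = y ^ 2 * of_nat a)"
  by (auto simp: square_class_def r_coset_def rat_unit_squares_def)

lemma square_class_carrier: "a > 0 \<Longrightarrow> square_class a \<in> carrier square_class_group"
  by (auto simp: square_class_def carrier_FactGroup)

lemma square_class_mult:
  "a > 0 \<Longrightarrow> b > 0 \<Longrightarrow> square_class a \<otimes>\<^bsub>square_class_group\<^esub> square_class b = square_class (a * b)"
  using rat_unit_squares.rcos_sum[of "of_nat a" "of_nat b"] by (simp add: square_class_def)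

lemma square_class_mult_square:
  assumes "c > 0"
  shows "square_class (c ^ 2 * a) = square_class a"
proof (rule equalityI; rule subsetI)
  fix x assume "x \<in> square_class (c ^ 2 * a)"
  then obtain y where "y \<noteq> 0" "x = y ^ 2 * of_nat (c ^ 2 * a)" by (auto simp: mem_square_class)
  hence "y * of_nat c \<noteq> 0" "x = (y * of_nat c) ^ 2 * of_nat a"
    using assms by (auto simp: power_mult_distrib)
  thus "x \<in> square_class a" unfolding mem_square_class by blast
next
  fix x assume "x \<in> square_class a"
  then obtain y where "y \<noteq> 0" "x = y ^ 2 * of_nat a" by (auto simp: mem_square_class)
  hence "y / of_nat c \<noteq> 0" "x = (y / of_nat c) ^ 2 * of_nat (c ^ 2 * a)"
    using assms by (auto simp: power_divide)
  thus "x \<in> square_class (c ^ 2 * a)" unfolding mem_square_class by blast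
qed

lemma square_class_1: "square_class 1 = \<one>\<^bsub>square_class_group\<^esub>"
  using rat_units.coset_mult_one[of rat_unit_squares] rat_unit_squares.subset
  by (simp add: square_class_def)

lemma squarefree_int_iff: "squarefree (int a) \<longleftrightarrow> squarefree a"
proof
  assume a: "squarefree (int a)"
  show "squarefree a" unfolding squarefree_def
  proof (intro allI impI)
    fix x assume "x ^ 2 dvd a"
    hence "int x ^ 2 dvd int a" by (metis of_nat_dvd_iff of_nat_power)
    hence "int x dvd 1" using a by (auto simp: squarefree_def)
    thus "x dvd 1" by simp
  qed
next
  assume a: "squarefree a"
  show "squarefree (int a)" unfolding squarefree_def
  proof (intro allI impI)
    fix x assume "x ^ 2 dvd int a"
    hence "int (nat \<bar>x\<bar> ^ 2) dvd int a" by simp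
    hence "nat \<bar>x\<bar> ^ 2 dvd a" by (simp only: of_nat_dvd_iff)
    hence "nat \<bar>x\<bar> dvd 1" using a unfolding squarefree_def by blast
    thus "x dvd 1" by simp
  qed
qed

text \<open>For \<open>x = p / q\<close> in lowest terms, \<open>q ^ 2\<close> divides
  \<open>b\<close> and \<open>p ^ 2\<close> divides \<open>a\<close>, so both are 1. This gives
  uniqueness of the squarefree representative of a square class, and later of the squarefree part of
  an ideal norm.\<close>

lemma squarefree_eq_of_square_ratio:
  fixes a b :: int and x :: rat
  assumes "squarefree a" "squarefree b" "a > 0" "b > 0" and eq: "of_int a = x ^ 2 * of_int b"
  shows "a = b"
proof -
  obtain p q where pq: "quotient_of x = (p, q)" by fastforce
  have q0: "q > 0" and cop: "coprime p q" and x: "x = of_int p / of_int q"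
    using quotient_of_denom_pos[OF pq] quotient_of_coprime[OF pq] quotient_of_div[OF pq] by auto
  have "(of_int (a * q ^ 2) :: rat) = of_int (p ^ 2 * b)"
    using eq q0 by (simp add: x power_divide field_simps)
  hence e: "a * q ^ 2 = p ^ 2 * b" by (simp only: of_int_eq_iff)
  have cop2: "coprime (q ^ 2) (p ^ 2)" using cop by (simp add: coprime_commute)
  have "q ^ 2 dvd p ^ 2 * b" using e by (metis dvd_triv_right)
  hence "q ^ 2 dvd b" using cop2 by (simp add: coprime_dvd_mult_right_iff)
  hence "q dvd 1" using assms(2) unfolding squarefree_def by blast
  hence q: "q ^ 2 = 1" by (simp add: abs_square_eq_1)
  have "p ^ 2 dvd a * q ^ 2" using e by simp
  hence "p ^ 2 dvd a" using q by simp
  hence "p dvd 1" using assms(1) unfolding squarefree_def by blast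
  hence "p ^ 2 = 1" by (simp add: abs_square_eq_1)
  thus ?thesis using e q by simp
qed

lemma square_class_inject:
  assumes "square_class a = square_class b" "squarefree a" "squarefree b"
  shows "a = b"
proof -
  have pos: "a > 0" "b > 0" using assms(2,3) by (auto intro: gr0I)
  have "of_nat a \<in> square_class a" unfolding mem_square_class by (auto intro: exI[of _ 1])
  hence "of_nat a \<in> square_class b" using assms(1) by simp
  then obtain y where "of_nat a = y ^ 2 * (of_nat b :: rat)" by (auto simp: mem_square_class)
  hence "int a = int b"
    using assms pos by (intro squarefree_eq_of_square_ratio[of "int a" "int b" y]) (auto simp: squarefree_int_iff)
  thus ?thesis by simp
qed

section \<open>The quadratic field\<close>

locale quadratic =
  fixes d D :: int
  assumes squarefree_d: "squarefree d" and d_neq_1: "d \<noteq> 1" and D_eq: "D = quad_disc d"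
begin

section \<open>Congruences of the discriminant and irrationality of its square root\<close>

lemma d_mod_4: "d mod 4 \<noteq> 0"
proof
  assume "d mod 4 = 0"
  hence "2 ^ 2 dvd d" by auto
  hence "(2::int) dvd 1" using squarefree_d unfolding squarefree_def by blast
  thus False by simp
qed

lemma D_cases: "D = d \<and> d mod 4 = 1 \<or> D = 4 * d \<and> (d mod 4 = 2 \<or> d mod 4 = 3)"
  using d_mod_4 by (auto simp: D_eq quad_disc_def) 

lemma D_nonzero: "D \<noteq> 0"
  using D_cases squarefree_d by auto

lemma square_neq_d: "x ^ 2 \<noteq> d" for x :: int
proof
  assume x: "x ^ 2 = d"
  hence "x dvd 1" using squarefree_d by (auto simp: squarefree_def)
  hence "x ^ 2 = 1" by (simp add: abs_square_eq_1)
  thus False using x d_neq_1 by simp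
qed

text \<open>A rational root would be an integer; for \<open>D = 4 * d\<close> it would be even, and
  half of it a root of \<open>d\<close>. Uniqueness of the coordinates in \<open>elt p q\<close>
  depends on this.\<close>

lemma rat_square_neq_D: "x ^ 2 \<noteq> of_int D" for x :: rat
proof
  assume x: "x ^ 2 = of_int D"
  obtain p q where pq: "quotient_of x = (p, q)" by fastforce
  have q0: "q > 0" and cop: "coprime p q" and r: "x = of_int p / of_int q"
    using quotient_of_denom_pos[OF pq] quotient_of_coprime[OF pq] quotient_of_div[OF pq] by auto
  have "(of_int (p ^ 2) :: rat) = of_int (D * q ^ 2)"
    using x q0 by (simp add: r power_divide field_simps)
  hence eq: "p ^ 2 = D * q ^ 2" by (simp only: of_int_eq_iff)
  hence "q ^ 2 dvd p ^ 2" by simp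
  hence "q dvd p" by simp
  hence "q = 1" using cop q0 by (metis coprime_absorb_right coprime_commute zdvd1_eq abs_of_pos)
  hence p: "p ^ 2 = D" using eq by simp
  show False
  proof (cases "D = d")
    case True thus False using p square_neq_d by simp
  next
    case False
    hence D: "D = 4 * d" using D_cases by auto
    hence "even (p ^ 2)" using p by simp
    hence "even p" by simp
    then obtain y where "p = 2 * y" by auto
    hence "y ^ 2 = d" using p D by (simp add: power_mult_distrib)
    thus False using square_neq_d by simp
  qed
qed

text \<open>No quadratic order properly contains the one of discriminant \<open>D\<close>.\<close>

lemma fundamental_discriminant:
  fixes T N h :: int
  assumes TN: "T ^ 2 - 4 * N = D" and "h dvd T" "h ^ 2 dvd N"
  shows "h dvd 1"
proof -
  have hD: "h ^ 2 dvd D"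
    using assms by (metis dvd_diff dvd_mult dvd_power_same)
  show ?thesis
  proof (cases "D = d")
    case True
    thus ?thesis using hD squarefree_d by (auto simp: squarefree_def)
  next
    case False
    hence D: "D = 4 * d" and dm: "d mod 4 = 2 \<or> d mod 4 = 3" using D_cases by auto
    have T2: "T ^ 2 = 4 * (N + d)" using TN D by simp
    hence "even (T ^ 2)" by simp
    hence "even T" by simp
    then obtain u where u: "T = 2 * u" by auto
    have ud: "u ^ 2 - N = d" using T2 by (simp add: u power_mult_distrib)
    \<comment> \<open>An even \<open>h\<close> would make 4 divide \<open>N\<close>, so
      \<open>d = u ^ 2 - N\<close> would be congruent to a square modulo 4, which 2 and 3 are
      not.\<close>
    have "odd h"
    proof
      assume "even h"
      then obtain h' where "h = 2 * h'" by auto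
      hence "4 dvd N" using assms(3) by (auto simp: power_mult_distrib)
      then obtain M where M: "N = 4 * M" by auto
      have "u mod 4 = 0 \<or> u mod 4 = 1 \<or> u mod 4 = 2 \<or> u mod 4 = 3" by presburger
      hence "u ^ 2 mod 4 = 0 \<or> u ^ 2 mod 4 = 1"
        by (auto simp: power2_eq_square mod_mult_eq[of u 4 u, symmetric])
      moreover have "d mod 4 = u ^ 2 mod 4"
        unfolding ud[symmetric] M by (simp add: mod_diff_eq[symmetric])
      ultimately show False using dm by auto
    qed
    hence "coprime (h ^ 2) 4"
      by (metis coprime_power_left_iff coprime_power_right_iff coprime_right_2_iff_odd mult_2 numeral_Bit0 power2_eq_square)
    moreover have "h ^ 2 dvd 4 * d" using hD D by simp
    ultimately have "h ^ 2 dvd d" by (simp add: coprime_dvd_mult_right_iff)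
    thus ?thesis using squarefree_d by (auto simp: squarefree_def)
  qed
qed

abbreviation K :: "complex set" where "K \<equiv> quad_field D"
abbreviation OK :: "complex set" where "OK \<equiv> quad_ints D"

section \<open>Coordinates, conjugation, norm and trace\<close>

definition sqrtD :: complex where "sqrtD = csqrt (of_int D)"

definition elt :: "rat \<Rightarrow> rat \<Rightarrow> complex" where
  "elt p q = of_rat p + of_rat q * sqrtD"

lemma sqrtD_square: "sqrtD * sqrtD = of_int D"
  unfolding sqrtD_def by (metis power2_csqrt power2_eq_square)

lemma elt_eq_0_iff: "elt p q = 0 \<longleftrightarrow> p = 0 \<and> q = 0"
proof
  assume z: "elt p q = 0"
  have "q = 0"
  proof (rule ccontr)
    assume "q \<noteq> 0"
    hence "sqrtD = of_rat (- p / q)"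
      using z by (simp add: elt_def of_rat_divide of_rat_minus field_simps add_eq_0_iff)
    hence "of_rat ((- p / q) ^ 2) = (of_rat (of_int D) :: complex)"
      using sqrtD_square by (simp add: power2_eq_square del: of_rat_minus minus_divide_left mult_minus_left flip: of_rat_mult)
    hence "(- p / q) ^ 2 = of_int D" by (simp only: of_rat_eq_iff)
    thus False using rat_square_neq_D by blast
  qed
  thus "p = 0 \<and> q = 0" using z by (simp add: elt_def)
qed (simp add: elt_def)

lemma elt_add: "elt p q + elt p' q' = elt (p + p') (q + q')"
  by (simp add: elt_def of_rat_add algebra_simps)

lemma elt_diff: "elt p q - elt p' q' = elt (p - p') (q - q')"
  by (simp add: elt_def of_rat_diff algebra_simps)

lemma elt_minus: "- elt p q = elt (- p) (- q)"
  by (simp add: elt_def of_rat_minus algebra_simps)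

lemma elt_mult: "elt p q * elt p' q' = elt (p * p' + of_int D * q * q') (p * q' + q * p')"
proof -
  have "elt p q * elt p' q' = of_rat p * of_rat p' + (sqrtD * sqrtD) * of_rat q * of_rat q' +
          (of_rat p * of_rat q' + of_rat q * of_rat p') * sqrtD"
    by (simp add: elt_def algebra_simps)
  thus ?thesis unfolding sqrtD_square by (simp add: elt_def of_rat_add of_rat_mult)
qed

lemma elt_inject: "elt p q = elt p' q' \<longleftrightarrow> p = p' \<and> q = q'"
  using elt_eq_0_iff[of "p - p'" "q - q'"] elt_diff[of p q p' q'] by auto

lemma of_rat_eq_elt: "of_rat p = elt p 0"
  by (simp add: elt_def)

lemma of_int_eq_elt: "of_int n = elt (of_int n) 0"
  by (simp add: elt_def)

lemma of_nat_eq_elt: "of_nat n = elt (of_nat n) 0"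
  by (simp add: elt_def)

lemma one_eq_elt: "1 = elt 1 0" and zero_eq_elt: "0 = elt 0 0"
  by (simp_all add: elt_def)

lemma K_eq: "K = {elt p q | p q. True}"
  unfolding quad_field_def elt_def sqrtD_def Rats_def by (auto 0 3)

lemma elt_in_K [simp]: "elt p q \<in> K"
  by (auto simp: K_eq)

lemma K_cases [elim?]: assumes "z \<in> K" obtains p q where "z = elt p q"
  using assms by (auto simp: K_eq)

text \<open>Coordinates with respect to 1 and \<open>sqrtD\<close>. They are meaningful only on
  \<open>K\<close>, which is why the laws below assume membership in \<open>K\<close>.\<close>

definition rp :: "complex \<Rightarrow> rat" where "rp z = (THE p. \<exists>q. z = elt p q)"
definition ip :: "complex \<Rightarrow> rat" where "ip z = (THE q. \<exists>p. z = elt p q)"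
definition cj :: "complex \<Rightarrow> complex" where "cj z = elt (rp z) (- ip z)"
definition nm :: "complex \<Rightarrow> rat" where "nm z = rp z ^ 2 - of_int D * ip z ^ 2"
definition tr :: "complex \<Rightarrow> rat" where "tr z = 2 * rp z"

lemma rp_elt [simp]: "rp (elt p q) = p" and ip_elt [simp]: "ip (elt p q) = q"
  by (auto simp: rp_def ip_def elt_inject)

lemma cj_elt [simp]: "cj (elt p q) = elt p (- q)"
  and nm_elt [simp]: "nm (elt p q) = p ^ 2 - of_int D * q ^ 2"
  and tr_elt [simp]: "tr (elt p q) = 2 * p"
  by (simp_all add: cj_def nm_def tr_def)

lemma K_add [simp, intro]: "x \<in> K \<Longrightarrow> y \<in> K \<Longrightarrow> x + y \<in> K"
  and K_diff [simp, intro]: "x \<in> K \<Longrightarrow> y \<in> K \<Longrightarrow> x - y \<in> K"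
  and K_mult [simp, intro]: "x \<in> K \<Longrightarrow> y \<in> K \<Longrightarrow> x * y \<in> K"
  and K_minus [simp, intro]: "x \<in> K \<Longrightarrow> - x \<in> K"
  by (auto simp: elt_add elt_diff elt_mult elt_minus elim!: K_cases)

lemma K_of_rat [simp, intro]: "of_rat r \<in> K" and K_of_int [simp, intro]: "of_int n \<in> K"
  and K_of_nat [simp, intro]: "of_nat k \<in> K"
  and K_0 [simp, intro]: "0 \<in> K" and K_1 [simp, intro]: "1 \<in> K"
  by (simp_all only: of_rat_eq_elt of_int_eq_elt of_nat_eq_elt zero_eq_elt one_eq_elt elt_in_K)

lemma K_power [simp, intro]: "x \<in> K \<Longrightarrow> x ^ n \<in> K"
  by (induction n) auto

lemma K_cj [simp, intro]: "cj x \<in> K"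
  by (simp add: cj_def)

lemma cj_cj [simp]: "x \<in> K \<Longrightarrow> cj (cj x) = x"
  by (auto elim!: K_cases)

lemma cj_add: "x \<in> K \<Longrightarrow> y \<in> K \<Longrightarrow> cj (x + y) = cj x + cj y"
  and cj_mult: "x \<in> K \<Longrightarrow> y \<in> K \<Longrightarrow> cj (x * y) = cj x * cj y"
  by (auto simp: elt_add elt_mult elim!: K_cases)

lemma cj_of_rat [simp]: "cj (of_rat r) = of_rat r" and cj_of_int [simp]: "cj (of_int n) = of_int n"
  and cj_0 [simp]: "cj 0 = 0" and cj_1 [simp]: "cj 1 = 1"
  by (simp_all add: of_rat_eq_elt of_int_eq_elt zero_eq_elt one_eq_elt)

lemma nm_of_rat [simp]: "nm (of_rat r) = r ^ 2" and nm_of_int [simp]: "nm (of_int n) = of_int n ^ 2"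
  and nm_0 [simp]: "nm 0 = 0" and nm_1 [simp]: "nm 1 = 1"
  by (simp_all add: of_rat_eq_elt of_int_eq_elt zero_eq_elt one_eq_elt)

lemma mult_cj: "x \<in> K \<Longrightarrow> x * cj x = of_rat (nm x)"
  and add_cj: "x \<in> K \<Longrightarrow> x + cj x = of_rat (tr x)"
  by (auto simp: of_rat_eq_elt elt_mult elt_add elt_inject power2_eq_square elim!: K_cases)

lemma nm_mult: "x \<in> K \<Longrightarrow> y \<in> K \<Longrightarrow> nm (x * y) = nm x * nm y"
  by (auto simp: elt_mult power2_eq_square algebra_simps elim!: K_cases)

lemma nm_add: "x \<in> K \<Longrightarrow> y \<in> K \<Longrightarrow> nm (x + y) = nm x + nm y + tr (x * cj y)"
  by (auto simp: elt_mult elt_add power2_eq_square algebra_simps elim!: K_cases)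

lemma nm_cj [simp]: "x \<in> K \<Longrightarrow> nm (cj x) = nm x" and tr_cj [simp]: "x \<in> K \<Longrightarrow> tr (cj x) = tr x"
  by (auto elim!: K_cases)

lemma nm_minus [simp]: "x \<in> K \<Longrightarrow> nm (- x) = nm x"
  by (auto simp: elt_minus elim!: K_cases)

lemma nm_power: "x \<in> K \<Longrightarrow> nm (x ^ n) = nm x ^ n"
  by (induction n) (auto simp: nm_mult)

lemma nm_eq_0_iff: assumes "x \<in> K" shows "nm x = 0 \<longleftrightarrow> x = 0"
proof
  assume "nm x = 0"
  hence "x * cj x = 0" using assms by (simp add: mult_cj)
  moreover have "cj x = 0 \<Longrightarrow> x = 0" using assms by (metis cj_0 cj_cj)
  ultimately show "x = 0" by auto
qed auto

lemma cj_eq_0_iff: "x \<in> K \<Longrightarrow> cj x = 0 \<longleftrightarrow> x = 0"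
  by (metis cj_0 cj_cj)

lemma inverse_eq_cj: "x \<in> K \<Longrightarrow> x \<noteq> 0 \<Longrightarrow> inverse x = of_rat (inverse (nm x)) * cj x"
  using mult_cj[of x] nm_eq_0_iff[of x]
  by (intro inverse_unique) (simp add: mult.left_commute[of x] flip: of_rat_mult)

lemma K_inverse [simp, intro]: "x \<in> K \<Longrightarrow> inverse x \<in> K"
  by (cases "x = 0") (auto simp: inverse_eq_cj)

lemma nm_inverse: assumes "x \<in> K" shows "nm (inverse x) = inverse (nm x)"
proof (cases "x = 0")
  case False
  have "nm x * nm (inverse x) = 1" using assms False by (simp flip: nm_mult)
  thus ?thesis by (simp add: inverse_unique)
qed auto

lemma quad_eq: "x \<in> K \<Longrightarrow> x * x = of_rat (tr x) * x - of_rat (nm x)"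
  by (simp add: algebra_simps flip: mult_cj add_cj)

lemma quad_conj_eq: "S \<subseteq> K \<Longrightarrow> quad_conj D S = cj ` S"
proof
  assume S: "S \<subseteq> K"
  show "quad_conj D S \<subseteq> cj ` S"
  proof
    fix z assume "z \<in> quad_conj D S"
    then obtain p q where "z = elt p (- q)" "elt p q \<in> S"
      by (auto simp: quad_conj_def elt_def sqrtD_def Rats_def of_rat_minus)
    thus "z \<in> cj ` S" by (auto intro!: image_eqI[of _ _ "elt p q"])
  qed
  show "cj ` S \<subseteq> quad_conj D S"
  proof
    fix z assume "z \<in> cj ` S"
    then obtain x where x: "x \<in> S" "z = cj x" by auto
    then obtain p q where "x = elt p q" using S K_cases by blast
    hence "z = of_rat p - of_rat q * sqrtD" "of_rat p + of_rat q * sqrtD \<in> S"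
      using x cj_elt[of p q] by (auto simp: elt_def of_rat_minus)
    moreover have "of_rat p \<in> (\<rat> :: complex set)" "of_rat q \<in> (\<rat> :: complex set)" by auto
    ultimately show "z \<in> quad_conj D S" unfolding quad_conj_def sqrtD_def by blast
  qed
qed

section \<open>The ring of integers\<close>

text \<open>A lattice for measuring denominators before an integral basis is available. What matters
  is closure under sums and integer multiples, and integrality of the norm.\<close>

definition int_lattice :: "complex set" where
  "int_lattice = {elt (of_int i) (of_int j) | i j. True}"

lemma int_lattice_add: "x \<in> int_lattice \<Longrightarrow> y \<in> int_lattice \<Longrightarrow> x + y \<in> int_lattice"
  unfolding int_lattice_def by (auto simp: elt_add) (metis of_int_add)

lemma int_lattice_mult_int: "x \<in> int_lattice \<Longrightarrow> of_int c * x \<in> int_lattice"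
  unfolding int_lattice_def by (auto simp: of_int_eq_elt elt_mult) (metis of_int_mult)

lemma int_lattice_0: "0 \<in> int_lattice"
  using int_lattice_def zero_eq_elt by (metis (mono_tags, lifting) mem_Collect_eq of_int_0)

lemma int_lattice_sum: "(\<And>i. i \<in> A \<Longrightarrow> f i \<in> int_lattice) \<Longrightarrow> sum f A \<in> int_lattice"
  by (induction A rule: infinite_finite_induct) (auto simp: int_lattice_0 int_lattice_add)

lemma int_lattice_nm: "x \<in> int_lattice \<Longrightarrow> nm x \<in> \<int>"
  unfolding int_lattice_def by auto

lemma K_denominator: assumes "z \<in> K" shows "\<exists>m>0. of_int m * z \<in> int_lattice"
proof -
  obtain p q where z: "z = elt p q" using assms K_cases by blast
  obtain a b where ab: "quotient_of p = (a, b)" by fastforce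
  obtain a' b' where ab': "quotient_of q = (a', b')" by fastforce
  have b: "b > 0" "b' > 0" using ab ab' quotient_of_denom_pos by auto
  have pq: "p = of_int a / of_int b" "q = of_int a' / of_int b'"
    using ab ab' quotient_of_div by auto
  have "of_int (b * b') * z = elt (of_int (b' * a)) (of_int (b * a'))"
    unfolding of_int_eq_elt z elt_mult elt_inject using b by (simp add: pq)
  thus ?thesis using b unfolding int_lattice_def
    by (metis (mono_tags, lifting) mem_Collect_eq mult_pos_pos)
qed

text \<open>An algebraic integer of \<open>K\<close> generates a ring with bounded denominators. This forces its norm, and that
  of its translate by \<open>1\<close>, to be an integer.\<close>

lemma algebraic_int_powers_bounded:
  assumes "z \<in> K" "algebraic_int z"
  shows "\<exists>m>0. \<forall>k. of_int m * z ^ k \<in> int_lattice"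
proof -
  from assms(2) obtain p :: "complex poly" where p: "Polynomial.lead_coeff p = 1" "\<forall>i. Polynomial.coeff p i \<in> \<int>" "poly p z = 0"
    by (auto elim: algebraic_int.cases)
  define n where "n = Polynomial.degree p"
  \<comment> \<open>A common denominator for finitely many powers; it is used for the exponents
    below the degree.\<close>
  have "\<exists>m>0. \<forall>k<j. of_int m * z ^ k \<in> int_lattice" for j :: nat
  proof (induction j)
    case (Suc j)
    then obtain m where m: "m > 0" "\<forall>k<j. of_int m * z ^ k \<in> int_lattice" by auto
    obtain m' where m': "m' > 0" "of_int m' * z ^ j \<in> int_lattice" using K_denominator[of "z ^ j"] assms by auto
    have "of_int (m * m') * z ^ k \<in> int_lattice" if "k < Suc j" for k
    proof (cases "k = j")
      case True thus ?thesis using int_lattice_mult_int[OF m'(2), of m] by (simp add: mult.assoc)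
    next
      case False
      hence "of_int m * z ^ k \<in> int_lattice" using m that by auto
      from int_lattice_mult_int[OF this, of m'] show ?thesis by (simp add: ac_simps)
    qed
    thus ?case using m m' by (intro exI[of _ "m * m'"]) auto
  qed (auto intro: exI[of _ 1])
  then obtain m where m: "m > 0" "\<forall>k<n. of_int m * z ^ k \<in> int_lattice" by blast
  have zn: "z ^ n = - (\<Sum>i<n. Polynomial.coeff p i * z ^ i)"
  proof -
    have "0 = (\<Sum>i\<le>n. Polynomial.coeff p i * z ^ i)" using p(3) by (simp add: poly_altdef n_def)
    also have "\<dots> = z ^ n + (\<Sum>i<n. Polynomial.coeff p i * z ^ i)"
      using p(1) by (simp add: lessThan_Suc_atMost[symmetric] n_def)
    finally show ?thesis by (simp add: eq_neg_iff_add_eq_0)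
  qed
  \<comment> \<open>The monic equation rewrites a power of exponent at least \<open>n\<close> as an
    integer combination of lower ones, so the same \<open>m\<close> serves for all
    exponents.\<close>
  have "of_int m * z ^ k \<in> int_lattice" for k
  proof (induction k rule: less_induct)
    case (less k)
    show ?case
    proof (cases "k < n")
      case False
      have "z ^ k = z ^ (k - n) * z ^ n" using False by (simp flip: power_add)
      hence "of_int m * z ^ k = (\<Sum>i<n. (- Polynomial.coeff p i) * (of_int m * z ^ (k - n + i)))"
        unfolding zn by (simp add: sum_distrib_left sum_negf power_add mult_ac)
      also have "\<dots> \<in> int_lattice"
      proof (rule int_lattice_sum)
        fix i assume "i \<in> {..<n}"
        hence "k - n + i < k" using False by auto
        hence l: "of_int m * z ^ (k - n + i) \<in> int_lattice" by (rule less)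
        obtain c where "Polynomial.coeff p i = of_int c" using p(2) by (metis Ints_cases)
        thus "- Polynomial.coeff p i * (of_int m * z ^ (k - n + i)) \<in> int_lattice"
          using int_lattice_mult_int[OF l, of "- c"] by simp
      qed
      finally show ?thesis .
    qed (use m in auto)
  qed
  thus ?thesis using m by blast
qed

text \<open>Taking norms turns the common denominator \<open>m\<close> of the powers of
  \<open>z\<close> into the common denominator \<open>m ^ 2\<close> of the powers of the rational
  number \<open>nm z\<close>.\<close>

lemma powers_bounded_imp_nm_int:
  assumes "z \<in> K" "m > 0" "\<And>k. of_int m * z ^ k \<in> int_lattice"
  shows "nm z \<in> \<int>"
proof (rule Ints_if_bounded_power_denominators)
  show "m ^ 2 > 0" using assms by simp
  show "of_int (m ^ 2) * nm z ^ k \<in> \<int>" for k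
    using int_lattice_nm[OF assms(3)[of k]] assms(1) by (simp add: nm_mult nm_power)
qed

lemma tr_eq_nm: "z \<in> K \<Longrightarrow> tr z = nm (z + 1) - nm z - 1"
  by (auto simp: one_eq_elt elt_add power2_eq_square algebra_simps elim!: K_cases)

lemma OK_iff: "z \<in> OK \<longleftrightarrow> z \<in> K \<and> tr z \<in> \<int> \<and> nm z \<in> \<int>"
proof
  assume "z \<in> OK"
  hence z: "z \<in> K" "algebraic_int z" by (auto simp: quad_ints_def)
  obtain m where m: "m > 0" "\<And>k. of_int m * z ^ k \<in> int_lattice"
    using algebraic_int_powers_bounded[OF z] by blast
  have 1: "nm z \<in> \<int>" using powers_bounded_imp_nm_int[OF z(1) m] .
  \<comment> \<open>By the binomial theorem the powers of \<open>z + 1\<close> are integer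
    combinations of those of \<open>z\<close>, so \<open>m\<close> is a common denominator for them
    too.\<close>
  have "of_int m * (z + 1) ^ k \<in> int_lattice" for k
  proof -
    have "of_int m * (z + 1) ^ k = (\<Sum>i\<le>k. of_int (int (k choose i)) * (of_int m * z ^ i))"
      by (simp add: binomial_ring sum_distrib_left mult_ac)
    also have "\<dots> \<in> int_lattice" by (intro int_lattice_sum int_lattice_mult_int m)
    finally show ?thesis .
  qed
  hence "nm (z + 1) \<in> \<int>" using powers_bounded_imp_nm_int[of "z + 1" m] z m by auto
  hence "tr z \<in> \<int>" using 1 by (simp add: tr_eq_nm z)
  thus "z \<in> K \<and> tr z \<in> \<int> \<and> nm z \<in> \<int>" using 1 z by simp
next
  assume z: "z \<in> K \<and> tr z \<in> \<int> \<and> nm z \<in> \<int>"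
  then obtain t n where tn: "tr z = of_int t" "nm z = of_int n" by (metis Ints_cases)
  have "algebraic_int z"
  proof (rule algebraic_int.intros)
    show "Polynomial.lead_coeff [:of_int n, - of_int t, 1 :: complex:] = 1" by simp
    show "\<forall>i. Polynomial.coeff [:of_int n, - of_int t, 1 :: complex:] i \<in> \<int>"
      by (auto simp: coeff_pCons split: nat.splits)
    show "poly [:of_int n, - of_int t, 1:] z = 0"
      using quad_eq[of z] z tn by (simp add: algebra_simps)
  qed
  thus "z \<in> OK" using z by (simp add: quad_ints_def)
qed

text \<open>The element (D + \<surd>D) / 2, of trace \<open>D\<close> and norm (D^2 - D) / 4. With
  it a single integral basis 1, \<omega> covers both residue classes of the discriminant modulo
  4.\<close>

definition \<omega> :: complex where "\<omega> = elt (of_int D / 2) (1 / 2)"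

lemma D_mod_4: "D mod 4 = 0 \<or> D mod 4 = 1"
  using D_cases by auto

lemma four_dvd_disc: "4 dvd D * D - D"
proof -
  have "D * D - D = D * (D - 1)" by (simp add: algebra_simps)
  moreover have "4 dvd D \<or> 4 dvd D - 1" using D_mod_4 by presburger
  ultimately show ?thesis by auto
qed

definition N\<omega> :: int where "N\<omega> = (D * D - D) div 4"

lemma N\<omega>: "4 * N\<omega> = D * D - D"
  using four_dvd_disc by (simp add: N\<omega>_def)

lemma N\<omega>_rat: "of_int N\<omega> = (of_int D * of_int D - of_int D) / (4 :: rat)"
  using arg_cong[OF N\<omega>, of "of_int :: int \<Rightarrow> rat"] by simp

lemma int_coord: "of_int x + of_int y * \<omega> = elt (of_int x + of_int y * of_int D / 2) (of_int y / 2)"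
  unfolding \<omega>_def of_int_eq_elt elt_mult elt_add by simp

lemma rat_coord: "of_rat x + of_rat y * \<omega> = elt (x + y * of_int D / 2) (y / 2)"
  unfolding \<omega>_def of_rat_eq_elt elt_mult elt_add by simp

lemma nm_coord: "nm (of_int x + of_int y * \<omega>) = of_int (x ^ 2 + D * x * y + N\<omega> * y ^ 2)"
  unfolding int_coord by (simp add: N\<omega>_rat power2_eq_square field_simps)

lemma tr_coord: "tr (of_int x + of_int y * \<omega>) = of_int (2 * x + D * y)"
  unfolding int_coord by (simp add: algebra_simps)

text \<open>Integral trace and norm make \<open>D * y ^ 2\<close> an integer for
  \<open>y = 2 * q\<close>, so the square of the denominator \<open>b\<close> of \<open>y\<close>
  divides \<open>D\<close>. If \<open>b\<close> is odd, \<open>b ^ 2\<close> divides the squarefree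
  \<open>d\<close>. If \<open>b\<close> is even, then \<open>D = 4 * d\<close> and
  \<open>b = 2\<close>, and reducing \<open>E * a ^ 2 = t ^ 2 - 4 * n\<close> modulo 4 makes
  \<open>d\<close> congruent to a square, which is impossible. A parity check then gives the integer
  \<open>x\<close>.\<close>

lemma OK_eq: "OK = {of_int x + of_int y * \<omega> | x y. True}"
proof
  show "{of_int x + of_int y * \<omega> | x y. True} \<subseteq> OK"
    by (auto simp: OK_iff nm_coord tr_coord) (simp add: int_coord)
  show "OK \<subseteq> {of_int x + of_int y * \<omega> | x y. True}"
  proof
    fix z assume z: "z \<in> OK"
    then obtain p q where pq: "z = elt p q" by (meson OK_iff K_cases)
    from z obtain t n where t: "2 * p = of_int t" and n: "p ^ 2 - of_int D * q ^ 2 = of_int n"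
      by (auto simp: OK_iff pq elim!: Ints_cases)
    define y where "y = 2 * q"
    have p: "p = of_int t / 2" and q: "q = y / 2" using t by (auto simp: y_def)
    have y: "of_int D * y ^ 2 = of_int (t ^ 2 - 4 * n)"
      using n by (simp add: p q power2_eq_square field_simps)
    obtain a b where ab: "quotient_of y = (a, b)" by fastforce
    have b: "b > 0" "coprime a b" "y = of_int a / of_int b"
      using quotient_of_denom_pos[OF ab] quotient_of_coprime[OF ab] quotient_of_div[OF ab] by auto
    have "(of_int (D * a ^ 2) :: rat) = of_int ((t ^ 2 - 4 * n) * b ^ 2)"
      using y b(1) by (simp add: b(3) power_divide field_simps)
    hence Dab: "D * a ^ 2 = (t ^ 2 - 4 * n) * b ^ 2" by (simp only: of_int_eq_iff)
    hence "b ^ 2 dvd D * a ^ 2" by simp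
    moreover have "coprime (b ^ 2) (a ^ 2)" using b(2) by (simp add: coprime_commute)
    ultimately have "b ^ 2 dvd D" by (simp add: coprime_dvd_mult_left_iff)
    then obtain E where E: "D = b ^ 2 * E" by auto
    have Ea: "E * a ^ 2 = t ^ 2 - 4 * n"
    proof -
      have "b ^ 2 * (E * a ^ 2) = b ^ 2 * (t ^ 2 - 4 * n)" using Dab E by (simp add: algebra_simps)
      thus ?thesis using b(1) by simp
    qed
    have "b = 1"
    proof (cases "odd b")
      case True
      hence "coprime (b ^ 2) 4"
        by (metis coprime_power_left_iff coprime_power_right_iff coprime_right_2_iff_odd mult_2 numeral_Bit0 power2_eq_square)
      hence "b ^ 2 dvd d" using \<open>b ^ 2 dvd D\<close> D_cases by (auto simp: coprime_dvd_mult_right_iff)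
      hence "b dvd 1" using squarefree_d by (auto simp: squarefree_def)
      thus ?thesis using b(1) by simp
    next
      case False
      then obtain c where c: "b = 2 * c" by auto
      have D4: "D = 4 * d"
      proof (rule ccontr)
        assume "D \<noteq> 4 * d"
        hence "D mod 4 = 1" using D_cases by auto
        moreover have "4 dvd D" using E c by (simp add: power_mult_distrib)
        ultimately show False by auto
      qed
      hence dE: "d = c ^ 2 * E" using E c by (simp add: power_mult_distrib)
      hence "c dvd 1" using squarefree_d by (auto simp: squarefree_def)
      hence "c ^ 2 = 1" by (simp add: abs_square_eq_1)
      hence dE: "d = E" using dE by simp
      have "odd a" using b(2) c by auto
      hence "a ^ 2 mod 4 = 1"
      proof -
        have "a mod 4 = 1 \<or> a mod 4 = 3" using \<open>odd a\<close> by presburger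
        thus ?thesis by (auto simp: power2_eq_square mod_mult_eq[of a 4 a, symmetric])
      qed
      hence "(E * a ^ 2) mod 4 = E mod 4" by (metis mod_mult_right_eq mult.right_neutral)
      hence "d mod 4 = t ^ 2 mod 4" unfolding Ea dE by (simp add: mod_diff_eq[symmetric])
      moreover have "t ^ 2 mod 4 = 0 \<or> t ^ 2 mod 4 = 1"
      proof -
        have "t mod 4 = 0 \<or> t mod 4 = 1 \<or> t mod 4 = 2 \<or> t mod 4 = 3" by presburger
        thus ?thesis by (auto simp: power2_eq_square mod_mult_eq[of t 4 t, symmetric])
      qed
      ultimately show ?thesis using D_cases D4 D_nonzero by auto
    qed
    hence y_int: "y = of_int a" using b by simp
    have "even (t - D * a)"
    proof -
      have "E = D" using E \<open>b = 1\<close> by simp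
      hence "even (t ^ 2 - D * a ^ 2)" using Ea by simp
      thus ?thesis by simp
    qed
    then obtain x where x: "t = D * a + 2 * x" by (metis add_diff_cancel_left' diff_add_cancel dvdE add.commute)
    have "z = of_int x + of_int a * \<omega>"
      unfolding int_coord pq elt_inject p q y_int by (simp add: x)
    thus "z \<in> {of_int x + of_int y * \<omega> | x y. True}" by blast
  qed
qed

lemma OK_K: "OK \<subseteq> K" by (auto simp: OK_iff)
lemma OK_in_K [simp, intro]: "x \<in> OK \<Longrightarrow> x \<in> K" by (simp add: OK_iff)

lemma \<omega>_in_K [simp]: "\<omega> \<in> K" by (simp add: \<omega>_def)

lemma \<omega>_square: "\<omega> * \<omega> = of_int D * \<omega> - of_int N\<omega>"
  unfolding \<omega>_def of_int_eq_elt elt_mult elt_diff elt_inject by (simp add: N\<omega>_rat field_simps)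

lemma OK_add [simp, intro]: "x \<in> OK \<Longrightarrow> y \<in> OK \<Longrightarrow> x + y \<in> OK"
proof -
  assume "x \<in> OK" "y \<in> OK"
  then obtain a b a' b' where "x = of_int a + of_int b * \<omega>" "y = of_int a' + of_int b' * \<omega>"
    by (auto simp: OK_eq)
  hence "x + y = of_int (a + a') + of_int (b + b') * \<omega>" by (simp add: algebra_simps)
  thus ?thesis unfolding OK_eq by blast
qed

lemma OK_mult [simp, intro]: "x \<in> OK \<Longrightarrow> y \<in> OK \<Longrightarrow> x * y \<in> OK"
proof -
  assume "x \<in> OK" "y \<in> OK"
  then obtain a b a' b' where xy: "x = of_int a + of_int b * \<omega>" "y = of_int a' + of_int b' * \<omega>"
    by (auto simp: OK_eq)
  have "x * y = of_int a * of_int a' + (of_int a * of_int b' + of_int b * of_int a') * \<omega>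
                  + of_int b * of_int b' * (\<omega> * \<omega>)"
    unfolding xy by (simp add: algebra_simps)
  also have "\<dots> = of_int (a * a' - b * b' * N\<omega>) + of_int (a * b' + b * a' + b * b' * D) * \<omega>"
    unfolding \<omega>_square by (simp add: algebra_simps)
  finally show ?thesis unfolding OK_eq by blast
qed

lemma OK_of_int [simp, intro]: "of_int n \<in> OK" and OK_of_nat [simp, intro]: "of_nat k \<in> OK"
  and OK_0 [simp, intro]: "0 \<in> OK" and OK_1 [simp, intro]: "1 \<in> OK"
  by (simp_all add: OK_iff of_nat_eq_elt of_int_eq_elt zero_eq_elt one_eq_elt)

lemma OK_minus [simp, intro]: "x \<in> OK \<Longrightarrow> - x \<in> OK"
  using OK_mult[of "- 1" x] OK_of_int[of "- 1"] by simp

lemma OK_cj [simp, intro]: "x \<in> OK \<Longrightarrow> cj x \<in> OK"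
  by (simp add: OK_iff)

lemma \<omega>_in_OK [simp]: "\<omega> \<in> OK"
  using tr_coord[of 0 1] nm_coord[of 0 1] by (simp add: OK_iff)

lemma of_rat_in_OK_iff: "of_rat r \<in> OK \<longleftrightarrow> r \<in> \<int>"
proof
  assume "of_rat r \<in> OK"
  then obtain x y where "elt r 0 = of_int x + of_int y * \<omega>" by (auto simp: OK_eq of_rat_eq_elt)
  hence "y = 0" "r = of_int x" by (auto simp: int_coord elt_inject)
  thus "r \<in> \<int>" by simp
qed (auto elim!: Ints_cases)

lemma nm_of_OK: "x \<in> OK \<Longrightarrow> \<exists>n. nm x = of_int n" and tr_of_OK: "x \<in> OK \<Longrightarrow> \<exists>t. tr x = of_int t"
  by (auto simp: OK_iff elim!: Ints_cases)

lemma K_denominator_OK: assumes "z \<in> K" shows "\<exists>m>0. of_int m * z \<in> OK"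
proof -
  obtain m where m: "m > 0" "of_int m * z \<in> int_lattice" using K_denominator[OF assms] by auto
  then obtain i j where ij: "of_int m * z = elt (of_int i) (of_int j)" by (auto simp: int_lattice_def)
  have "tr (of_int m * z) \<in> \<int>" "nm (of_int m * z) \<in> \<int>" unfolding ij by auto
  hence "of_int m * z \<in> OK" unfolding OK_iff using assms by blast
  thus ?thesis using m by blast
qed

section \<open>Fractional ideals\<close>

abbreviation imul :: "complex set \<Rightarrow> complex set \<Rightarrow> complex set" (infixl \<open>\<star>\<close> 70) where
  "I \<star> J \<equiv> ideal_prod (ring_on K) I J"

abbreviation FI :: "complex set \<Rightarrow> bool" where "FI J \<equiv> fractional_ideal D J"

definition principal :: "complex \<Rightarrow> complex set" where "principal x = (\<lambda>y. x * y) ` OK"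

section \<open>The product of sets of field elements\<close>

lemma imulI: "x \<in> I \<Longrightarrow> y \<in> J \<Longrightarrow> x * y \<in> I \<star> J"
  using ideal_prod.prod[of x I y J "ring_on K"] by (simp add: ring_on_def)

lemma imul_add: "x \<in> I \<star> J \<Longrightarrow> y \<in> I \<star> J \<Longrightarrow> x + y \<in> I \<star> J"
  using ideal_prod.sum[of x "ring_on K" I J y] by (simp add: ring_on_def)

lemma imul_induct [consumes 1, case_names prod add]:
  assumes "x \<in> I \<star> J" and "\<And>i j. i \<in> I \<Longrightarrow> j \<in> J \<Longrightarrow> Q (i * j)"
    and "\<And>s t. s \<in> I \<star> J \<Longrightarrow> t \<in> I \<star> J \<Longrightarrow> Q s \<Longrightarrow> Q t \<Longrightarrow> Q (s + t)"
  shows "Q x"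
  using assms(1)
proof (induction rule: ideal_prod.induct)
  case (prod i j)
  thus ?case using assms(2) by (simp add: ring_on_def)
next
  case (sum s1 s2)
  thus ?case using assms(3) by (simp add: ring_on_def)
qed

lemma imul_subset:
  assumes "\<And>x y. x \<in> I \<Longrightarrow> y \<in> J \<Longrightarrow> x * y \<in> M" and "\<And>x y. x \<in> M \<Longrightarrow> y \<in> M \<Longrightarrow> x + y \<in> M"
  shows "I \<star> J \<subseteq> M"
proof
  fix x assume "x \<in> I \<star> J"
  thus "x \<in> M" by (induction rule: imul_induct) (auto intro: assms)
qed

lemma imul_mono: "I \<subseteq> I' \<Longrightarrow> J \<subseteq> J' \<Longrightarrow> I \<star> J \<subseteq> I' \<star> J'"
  by (rule imul_subset) (auto intro: imulI imul_add)

lemma imul_comm: "I \<star> J = J \<star> I"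
proof -
  have "I \<star> J \<subseteq> J \<star> I" for I J
    by (rule imul_subset) (metis imulI mult.commute, rule imul_add)
  thus ?thesis by blast
qed

lemma imul_assoc: "(I \<star> J) \<star> L = I \<star> (J \<star> L)"
proof -
  have sub: "(I \<star> J) \<star> L \<subseteq> I \<star> (J \<star> L)" for I J L
  proof (rule imul_subset)
    fix x l assume "x \<in> I \<star> J" "l \<in> L"
    thus "x * l \<in> I \<star> (J \<star> L)"
      by (induction rule: imul_induct) (auto simp: mult.assoc distrib_right intro: imulI imul_add)
  qed (rule imul_add)
  have "I \<star> (J \<star> L) = (L \<star> J) \<star> I" by (metis imul_comm)
  also have "\<dots> \<subseteq> L \<star> (J \<star> I)" by (rule sub)
  also have "\<dots> = (I \<star> J) \<star> L" by (metis imul_comm)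
  finally show ?thesis using sub by blast
qed

lemma imul_left_commute: "I \<star> (J \<star> L) = J \<star> (I \<star> L)"
  by (metis imul_assoc imul_comm)

lemmas imul_ac = imul_assoc imul_comm imul_left_commute

section \<open>Closure properties of fractional ideals\<close>

lemma FI_subset: "FI J \<Longrightarrow> J \<subseteq> K" and FI_0: "FI J \<Longrightarrow> 0 \<in> J"
  and FI_add: "FI J \<Longrightarrow> x \<in> J \<Longrightarrow> y \<in> J \<Longrightarrow> x + y \<in> J"
  and FI_mult: "FI J \<Longrightarrow> c \<in> OK \<Longrightarrow> x \<in> J \<Longrightarrow> c * x \<in> J"
  by (auto simp: fractional_ideal_def)

lemma FI_K: "FI J \<Longrightarrow> x \<in> J \<Longrightarrow> x \<in> K" using FI_subset by auto

lemma FI_minus: "FI J \<Longrightarrow> x \<in> J \<Longrightarrow> - x \<in> J"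
  using FI_mult[of J "- 1" x] OK_minus[of 1] by simp

lemma FI_diff: "FI J \<Longrightarrow> x \<in> J \<Longrightarrow> y \<in> J \<Longrightarrow> x - y \<in> J"
  using FI_add[of J x "- y"] FI_minus by simp

lemma FI_mult_int: "FI J \<Longrightarrow> x \<in> J \<Longrightarrow> of_int n * x \<in> J"
  by (rule FI_mult) auto

lemma FI_nonzero: "FI J \<Longrightarrow> \<exists>x\<in>J. x \<noteq> 0"
  by (auto simp: fractional_ideal_def)

text \<open>Multiplying a denominator \<open>c\<close> by its conjugate turns it into the nonzero
  integer \<open>nm c\<close>; the absolute value makes it positive.\<close>

lemma FI_denominator: assumes "FI J" shows "\<exists>m>0. \<forall>x\<in>J. of_int m * x \<in> OK"
proof -
  obtain c where c: "c \<in> OK" "c \<noteq> 0" "\<And>x. x \<in> J \<Longrightarrow> c * x \<in> OK"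
    using assms unfolding fractional_ideal_def by blast
  obtain n where n: "nm c = of_int n" using c(1) nm_of_OK by blast
  have "n \<noteq> 0" using c nm_eq_0_iff[of c] n by auto
  have cc: "c * cj c = of_int n" using mult_cj[of c] c n by simp
  have mem: "of_int n * x \<in> OK" if "x \<in> J" for x
  proof -
    have "cj c * (c * x) \<in> OK" using c that by auto
    thus ?thesis by (metis cc mult.assoc mult.commute)
  qed
  have "of_int \<bar>n\<bar> * x \<in> OK" if "x \<in> J" for x
    using mem[OF that] OK_minus[OF mem[OF that]] by (cases "n \<ge> 0") auto
  thus ?thesis using \<open>n \<noteq> 0\<close> by (intro exI[of _ "\<bar>n\<bar>"]) auto
qed

lemma FI_I:
  assumes "J \<subseteq> K" "\<And>x y. x \<in> J \<Longrightarrow> y \<in> J \<Longrightarrow> x + y \<in> J"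
    "\<And>c x. c \<in> OK \<Longrightarrow> x \<in> J \<Longrightarrow> c * x \<in> J" "\<exists>x\<in>J. x \<noteq> 0"
    "m > 0" "\<And>x. x \<in> J \<Longrightarrow> of_int m * x \<in> OK"
  shows "FI J"
  unfolding fractional_ideal_def
proof (intro conjI ballI)
  show "0 \<in> J" using assms(3)[of 0] assms(4) by auto
  show "\<exists>c\<in>OK. c \<noteq> 0 \<and> (\<forall>x\<in>J. c * x \<in> OK)"
    using assms(5,6) by (intro bexI[of _ "of_int m"]) auto
qed (use assms in auto)

lemma FI_imul: assumes "FI I" "FI J" shows "FI (I \<star> J)"
proof -
  obtain m where m: "m > 0" "\<And>x. x \<in> I \<Longrightarrow> of_int m * x \<in> OK" using FI_denominator[OF assms(1)] by blast
  obtain n where n: "n > 0" "\<And>x. x \<in> J \<Longrightarrow> of_int n * x \<in> OK" using FI_denominator[OF assms(2)] by blast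
  show ?thesis
  proof (rule FI_I)
    show "I \<star> J \<subseteq> K" by (rule imul_subset) (auto intro: assms FI_K)
    show "c * x \<in> I \<star> J" if "c \<in> OK" "x \<in> I \<star> J" for c x
      using that(2)
    proof (induction rule: imul_induct)
      case (prod i j)
      thus ?case using imulI[of "c * i" I j J] FI_mult[OF assms(1) that(1)] by (simp add: mult.assoc)
    qed (simp add: distrib_left imul_add)
    obtain x y where "x \<in> I" "x \<noteq> 0" "y \<in> J" "y \<noteq> 0" using assms FI_nonzero by meson
    thus "\<exists>x\<in>I \<star> J. x \<noteq> 0" by (intro bexI[of _ "x * y"]) (auto intro: imulI)
    show "m * n > 0" using m n by simp
    show "of_int (m * n) * x \<in> OK" if "x \<in> I \<star> J" for x using that
    proof (induction rule: imul_induct)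
      case (prod i j)
      have "of_int (m * n) * (i * j) = (of_int m * i) * (of_int n * j)" by simp
      thus ?case using m(2) n(2) prod by (simp only:) (rule OK_mult)
    qed (simp add: distrib_left)
  qed (rule imul_add)
qed

lemma FI_cj: assumes "FI J" shows "FI (cj ` J)"
proof -
  obtain m where m: "m > 0" "\<And>x. x \<in> J \<Longrightarrow> of_int m * x \<in> OK" using FI_denominator[OF assms(1)] by blast
  show ?thesis
  proof (rule FI_I)
    show "x + y \<in> cj ` J" if xy: "x \<in> cj ` J" "y \<in> cj ` J" for x y
    proof -
      obtain u v where uv: "u \<in> J" "v \<in> J" "x = cj u" "y = cj v" using xy by auto
      hence "x + y = cj (u + v)" using FI_K[OF assms] by (simp add: cj_add)
      thus ?thesis using FI_add[OF assms] uv by auto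
    qed
    show "c * x \<in> cj ` J" if cx: "c \<in> OK" "x \<in> cj ` J" for c x
    proof -
      obtain y where y: "y \<in> J" "x = cj y" using cx by auto
      have "c * x = cj (cj c * y)" using y cx assms by (simp add: cj_mult FI_K)
      thus ?thesis using FI_mult[OF assms, of "cj c" y] y cx by auto
    qed
    obtain x where "x \<in> J" "x \<noteq> 0" using assms FI_nonzero by blast
    thus "\<exists>x\<in>cj ` J. x \<noteq> 0" using FI_K[OF assms] cj_eq_0_iff by auto
    show "of_int m * x \<in> OK" if xc: "x \<in> cj ` J" for x
    proof -
      obtain y where y: "y \<in> J" "x = cj y" using xc by auto
      have "of_int m * x = cj (of_int m * y)" using y that assms by (simp add: cj_mult FI_K)
      thus ?thesis using m y by auto
    qed
  qed (use m in auto)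
qed

lemma FI_principal: assumes "x \<in> K" "x \<noteq> 0" shows "FI (principal x)"
proof -
  obtain m where m: "m > 0" "of_int m * x \<in> OK" using K_denominator_OK[OF assms(1)] by blast
  show ?thesis
  proof (rule FI_I)
    show "principal x \<subseteq> K" using assms by (auto simp: principal_def)
    show "\<exists>y\<in>principal x. y \<noteq> 0" unfolding principal_def using assms(2) by (intro bexI[of _ "x * 1"]) auto
    show "y + z \<in> principal x" if "y \<in> principal x" "z \<in> principal x" for y z
      using that by (auto simp: principal_def simp flip: distrib_left)
    show "c * y \<in> principal x" if "c \<in> OK" "y \<in> principal x" for c y
      using that by (auto simp: principal_def mult.left_commute)
    show "of_int m * y \<in> OK" if "y \<in> principal x" for y
      using that OK_mult[OF m(2)] by (auto simp: principal_def mult.assoc)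
  qed (rule m)
qed

lemma principal_imul: assumes "FI J" "x \<in> K" shows "principal x \<star> J = (\<lambda>y. x * y) ` J"
proof
  show "principal x \<star> J \<subseteq> (\<lambda>y. x * y) ` J"
  proof (rule imul_subset)
    show "y * z \<in> (\<lambda>y. x * y) ` J" if "y \<in> principal x" "z \<in> J" for y z
      using that FI_mult[OF assms(1)] by (auto simp: principal_def mult.assoc)
    show "y + z \<in> (\<lambda>y. x * y) ` J" if "y \<in> (\<lambda>y. x * y) ` J" "z \<in> (\<lambda>y. x * y) ` J" for y z
      using that FI_add[OF assms(1)] by (auto simp flip: distrib_left)
  qed
  have "x \<in> principal x" by (auto simp: principal_def intro: image_eqI[of _ _ 1])
  thus "(\<lambda>y. x * y) ` J \<subseteq> principal x \<star> J" by (auto intro: imulI)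
qed

lemma principal_1: "principal 1 = OK" by (simp add: principal_def)

lemma FI_OK: "FI OK" using FI_principal[of 1] by (simp add: principal_1)

lemma principal_principal: "x \<in> K \<Longrightarrow> y \<in> K \<Longrightarrow> y \<noteq> 0 \<Longrightarrow> principal x \<star> principal y = principal (x * y)"
  using principal_imul[OF FI_principal, of y x] by (simp add: principal_def image_image mult.assoc)

lemma OK_imul: "FI J \<Longrightarrow> OK \<star> J = J" and imul_OK: "FI J \<Longrightarrow> J \<star> OK = J"
  using principal_imul[of J 1] imul_comm[of J OK] by (simp_all add: principal_1)

section \<open>Conjugate ideals, ideal norms and invertibility\<close>

lemma cj_cj_image: "I \<subseteq> K \<Longrightarrow> cj ` (cj ` I) = I"
  by (force simp: image_image)

lemma cj_imul: assumes "I \<subseteq> K" "J \<subseteq> K" shows "cj ` (I \<star> J) = cj ` I \<star> cj ` J"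
proof -
  have sub: "cj ` (I \<star> J) \<subseteq> cj ` I \<star> cj ` J" if "I \<subseteq> K" "J \<subseteq> K" for I J
  proof -
    have "x \<in> K \<and> cj x \<in> cj ` I \<star> cj ` J" if "x \<in> I \<star> J" for x
      using that
    proof (induction rule: imul_induct)
      case (prod i j)
      hence "i \<in> K" "j \<in> K" using \<open>I \<subseteq> K\<close> \<open>J \<subseteq> K\<close> by auto
      thus ?case using prod by (auto simp: cj_mult intro: imulI)
    qed (auto simp: cj_add intro: imul_add)
    thus ?thesis by auto
  qed
  have IK: "I \<star> J \<subseteq> K" using assms by (intro imul_subset) auto
  have "cj ` I \<star> cj ` J = cj ` (cj ` (cj ` I \<star> cj ` J))"
    by (rule cj_cj_image[symmetric], rule imul_subset) auto
  also have "\<dots> \<subseteq> cj ` (cj ` (cj ` I) \<star> cj ` (cj ` J))"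
    by (intro image_mono sub) auto
  also have "\<dots> = cj ` (I \<star> J)" using assms by (simp add: cj_cj_image)
  finally show ?thesis using sub[OF assms] by blast
qed

lemma cj_principal: assumes "x \<in> K" shows "cj ` principal x = principal (cj x)"
proof -
  have "cj ` principal x = (\<lambda>y. cj x * cj y) ` OK"
    unfolding principal_def image_image by (intro image_cong) (auto simp: cj_mult assms)
  also have "\<dots> = (\<lambda>y. cj x * y) ` (cj ` OK)" by (simp add: image_image)
  also have "cj ` OK = OK"
  proof
    show "OK \<subseteq> cj ` OK" using cj_cj OK_cj by (metis OK_in_K image_eqI subsetI)
  qed auto
  finally show ?thesis by (simp add: principal_def)
qed

text \<open>The rational numbers in \<open>J \<star> cj ` J\<close> form a cyclic group, say \<open>\<int> g\<close>. For \<open>x, y \<in> J\<close> the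
  trace and the norm of \<open>x * cj y / g\<close> are integers, hence \<open>J \<star> cj ` J\<close> is generated by \<open>g\<close>.\<close>

lemma imul_cj_principal:
  assumes J: "FI J"
  shows "\<exists>g>0. J \<star> cj ` J = principal (of_rat g)"
proof -
  define M where "M = J \<star> cj ` J"
  have M: "FI M" unfolding M_def by (intro FI_imul FI_cj J)
  define S where "S = {r. of_rat r \<in> M}"
  obtain m where m: "m > 0" "\<And>x. x \<in> M \<Longrightarrow> of_int m * x \<in> OK" using FI_denominator[OF M] by blast
  have nmS: "nm x \<in> S" if "x \<in> J" for x
    using imulI[OF that, of "cj x" "cj ` J"] that FI_K[OF J] by (simp add: S_def M_def mult_cj)
  have trS: "tr (x * cj y) \<in> S" if "x \<in> J" "y \<in> J" for x y
  proof -
    have K: "x \<in> K" "y \<in> K" using that FI_K[OF J] by auto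
    have "of_rat (tr (x * cj y)) = x * cj y + y * cj x"
      using add_cj[of "x * cj y"] K by (simp add: cj_mult mult.commute)
    also have "\<dots> \<in> M" unfolding M_def using that by (auto intro!: imul_add imulI)
    finally show ?thesis by (simp add: S_def)
  qed
  have "\<exists>g>0. S = {of_int k * g | k. True}"
  proof (rule rat_subgroup_cyclic)
    show "x - y \<in> S" if "x \<in> S" "y \<in> S" for x y
      using that FI_diff[OF M] by (simp add: S_def of_rat_diff)
    show "of_int m * x \<in> \<int>" if "x \<in> S" for x
    proof -
      have "of_rat (of_int m * x) \<in> OK" using that m(2) by (simp add: S_def of_rat_mult)
      thus ?thesis by (simp only: of_rat_in_OK_iff)
    qed
    obtain x where "x \<in> J" "x \<noteq> 0" using FI_nonzero[OF J] by blast
    thus "\<exists>x\<in>S. x \<noteq> 0" using nmS FI_K[OF J] nm_eq_0_iff by blast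
  qed (rule m)
  then obtain g where g: "g > 0" and S: "S = {of_int k * g | k. True}" by blast
  have "M = principal (of_rat g)"
  proof
    show "M \<subseteq> principal (of_rat g)" unfolding M_def
    proof (rule imul_subset)
      fix x y' assume xy: "x \<in> J" "y' \<in> cj ` J"
      then obtain y where y: "y \<in> J" "y' = cj y" by auto
      have K: "x \<in> K" "y \<in> K" using xy y FI_K[OF J] by auto
      obtain a b c where abc: "nm x = of_int a * g" "nm y = of_int b * g" "tr (x * cj y) = of_int c * g"
        using nmS[OF xy(1)] nmS[OF y(1)] trS[OF xy(1) y(1)] by (auto simp: S)
      \<comment> \<open>The norm of \<open>z\<close> is the product of \<open>nm x / g\<close> and
        \<open>nm y / g\<close>, each an integer because norms of elements of \<open>J\<close> lie
        in \<open>S\<close>.\<close>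
      define z where "z = of_rat (inverse g) * (x * cj y)"
      have zK: "z \<in> K" using K by (simp add: z_def)
      have "tr z = inverse g * tr (x * cj y)"
        using K unfolding z_def of_rat_eq_elt by (auto simp: elt_mult elim!: K_cases)
      hence "tr z = of_int c" using g by (simp add: abc)
      moreover have "nm z = of_int (a * b)"
        using K g unfolding z_def by (simp add: nm_mult abc power2_eq_square field_simps)
      ultimately have "z \<in> OK" using zK by (simp add: OK_iff)
      moreover have "x * y' = of_rat g * z"
        using g by (simp add: z_def y of_rat_inverse)
      ultimately show "x * y' \<in> principal (of_rat g)" by (auto simp: principal_def)
    next
      show "x + y \<in> principal (of_rat g)" if "x \<in> principal (of_rat g)" "y \<in> principal (of_rat g)" for x y
        by (rule FI_add[OF FI_principal that]) (use g in auto)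
    qed
    have "of_rat g \<in> M" using S by (auto simp: S_def intro: exI[of _ 1])
    thus "principal (of_rat g) \<subseteq> M" using FI_mult[OF M] by (auto simp: principal_def mult.commute)
  qed
  thus ?thesis using g by (auto simp: M_def)
qed

text \<open>Both quotients \<open>h / g\<close> and \<open>g / h\<close> are positive integers,
  hence 1. Identities between ideals thus become identities between their positive rational
  generators.\<close>

lemma principal_of_rat_inject:
  assumes "principal (of_rat g) = principal (of_rat h)" "g > 0" "h > 0"
  shows "g = h"
proof -
  have *: "h / g \<in> \<int>" if "principal (of_rat g) = principal (of_rat h)" "g > 0" for g h :: rat
  proof -
    have "of_rat h \<in> principal (of_rat h)" by (auto simp: principal_def intro: image_eqI[of _ _ 1])
    hence "of_rat h \<in> principal (of_rat g)" using that(1) by simp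
    then obtain y where y: "y \<in> OK" "of_rat h = of_rat g * y" by (auto simp: principal_def)
    hence "of_rat (h / g) = y" using that(2) by (simp add: of_rat_divide)
    thus ?thesis using y of_rat_in_OK_iff by metis
  qed
  obtain a b where ab: "h / g = of_int a" "g / h = of_int b"
    using *[of g h] *[of h g] assms by (metis Ints_cases)
  have a: "a > 0" "b > 0" using ab assms by (metis divide_pos_pos of_int_0_less_iff)+
  have "(of_int (a * b) :: rat) = of_int 1" using ab assms by (simp flip: ab)
  hence "a * b = 1" by (simp only: of_int_eq_iff)
  hence "a = 1" using a by (simp add: zmult_eq_1_iff)
  thus ?thesis using ab assms by simp
qed

lemma carrier_ideal_group [simp]: "carrier (ideal_group D) = {J. FI J}"
  and mult_ideal_group [simp]: "I \<otimes>\<^bsub>ideal_group D\<^esub> J = I \<star> J"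
  and one_ideal_group [simp]: "\<one>\<^bsub>ideal_group D\<^esub> = OK"
  by (simp_all add: ideal_group_def)

text \<open>If \<open>g\<close> generates the product of \<open>J\<close> with its conjugate, the
  inverse of \<open>J\<close> is the conjugate divided by \<open>g\<close>.\<close>

sublocale IG: comm_group "ideal_group D"
proof (rule comm_groupI)
  fix J assume "J \<in> carrier (ideal_group D)"
  hence J: "FI J" by simp
  then obtain g where g: "g > 0" "J \<star> cj ` J = principal (of_rat g)" using imul_cj_principal by blast
  have "principal (of_rat (inverse g)) \<star> cj ` J \<star> J = principal (of_rat (inverse g)) \<star> principal (of_rat g)"
    using g by (metis imul_assoc imul_comm)
  also have "\<dots> = OK" using g by (simp add: principal_principal principal_1 flip: of_rat_mult)
  finally show "\<exists>y\<in>carrier (ideal_group D). y \<otimes>\<^bsub>ideal_group D\<^esub> J = \<one>\<^bsub>ideal_group D\<^esub>"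
    using g J by (intro bexI[of _ "principal (of_rat (inverse g)) \<star> cj ` J"]) (auto intro!: FI_imul FI_cj FI_principal)
qed (simp_all add: FI_imul FI_OK OK_imul imul_assoc, rule imul_comm)

lemma imul_cancel: "FI I \<Longrightarrow> FI J \<Longrightarrow> FI L \<Longrightarrow> L \<star> I = L \<star> J \<Longrightarrow> I = J"
  using IG.l_cancel[of L I J] by simp

section \<open>Total positivity\<close>

lemma ring_hom_K:
  assumes "\<sigma> \<in> ring_hom (ring_on K) (ring_on (UNIV :: real set))"
  shows "x \<in> K \<Longrightarrow> y \<in> K \<Longrightarrow> \<sigma> (x + y) = \<sigma> x + \<sigma> y"
    and "x \<in> K \<Longrightarrow> y \<in> K \<Longrightarrow> \<sigma> (x * y) = \<sigma> x * \<sigma> y" and "\<sigma> 1 = 1"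
  using assms by (auto simp: ring_hom_def ring_on_def)

lemma ring_hom_K_of_rat:
  assumes s: "\<sigma> \<in> ring_hom (ring_on K) (ring_on (UNIV :: real set))"
  shows "\<sigma> (of_rat r) = of_rat r"
proof -
  note h = ring_hom_K[OF s]
  have 0: "\<sigma> 0 = 0" using h(1)[of 0 0] by simp
  have nat: "\<sigma> (of_nat n) = of_nat n" for n
    by (induction n) (simp_all add: 0 h)
  have int: "\<sigma> (of_int n) = of_int n" for n
  proof (cases "n \<ge> 0")
    case True thus ?thesis using nat[of "nat n"] by simp
  next
    case False
    have "(of_int n + of_nat (nat (- n)) :: complex) = 0" using False by simp
    hence "\<sigma> (of_int n) + \<sigma> (of_nat (nat (- n))) = 0" by (metis h(1) 0 K_of_int K_of_nat)
    thus ?thesis using False unfolding nat by simp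
  qed
  obtain a b where ab: "quotient_of r = (a, b)" by fastforce
  have b: "b > 0" "r = of_int a / of_int b" using quotient_of_denom_pos[OF ab] quotient_of_div[OF ab] by auto
  have "\<sigma> (of_int b) * \<sigma> (of_rat r) = \<sigma> (of_int b * of_rat r)" by (simp add: h)
  also have "of_int b * of_rat r = (of_int a :: complex)" using b by (simp add: of_rat_divide)
  finally have "of_int b * \<sigma> (of_rat r) = of_int a" by (simp only: int)
  moreover have "of_rat r = (of_int a / of_int b :: real)" by (simp add: b(2) of_rat_divide)
  ultimately have "of_int b * \<sigma> (of_rat r) = of_int b * of_rat r" using b(1) by simp
  thus ?thesis using b(1) by simp
qed

lemma ring_hom_K_elt:
  assumes s: "\<sigma> \<in> ring_hom (ring_on K) (ring_on (UNIV :: real set))"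
  shows "\<exists>v. v * v = of_int D \<and> (\<forall>p q. \<sigma> (elt p q) = of_rat p + of_rat q * v)"
proof (intro exI conjI allI)
  note h = ring_hom_K[OF s]
  have sqrtD: "sqrtD = elt 0 1" by (simp add: elt_def)
  hence wK: "sqrtD \<in> K" by simp
  have "\<sigma> sqrtD * \<sigma> sqrtD = \<sigma> (of_rat (of_int D))" using h(2)[OF wK wK] by (simp add: sqrtD_square)
  thus "\<sigma> sqrtD * \<sigma> sqrtD = of_int D" unfolding ring_hom_K_of_rat[OF s] by simp
  show "\<sigma> (elt p q) = of_rat p + of_rat q * \<sigma> sqrtD" for p q
    by (simp add: elt_def h wK ring_hom_K_of_rat[OF s])
qed

lemma ring_hom_K_exists:
  assumes "v * v = of_int D"
  shows "(\<lambda>z. of_rat (rp z) + of_rat (ip z) * v) \<in> ring_hom (ring_on K) (ring_on (UNIV :: real set))"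
proof -
  have v: "v * (v * a) = of_int D * a" for a by (simp flip: mult.assoc assms)
  show ?thesis unfolding ring_hom_def
    by (auto simp: ring_on_def elt_add elt_mult of_rat_add of_rat_mult one_eq_elt algebra_simps v
          elim!: K_cases)
qed

text \<open>A real embedding sends \<open>sqrtD\<close> to a real square root of \<open>D\<close>.
  For \<open>D > 0\<close> there are two, and the two images of \<open>x\<close> are both positive
  exactly when their product \<open>nm x\<close> and their sum \<open>tr x\<close> are. For
  \<open>D < 0\<close> there is none and the condition is empty.\<close>

lemma totally_positive_iff:
  "totally_positive D x \<longleftrightarrow> x \<in> K \<and> x \<noteq> 0 \<and> (D > 0 \<longrightarrow> nm x > 0 \<and> tr x > 0)"
proof (cases "x \<in> K")
  case True
  then obtain p q where x: "x = elt p q" using K_cases by blast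
  show ?thesis
  proof (cases "D > 0")
    case False
    have "\<not> \<sigma> \<in> ring_hom (ring_on K) (ring_on (UNIV :: real set))" for \<sigma>
    proof
      assume "\<sigma> \<in> ring_hom (ring_on K) (ring_on (UNIV :: real set))"
      then obtain v :: real where v: "v * v = of_int D" using ring_hom_K_elt by blast
      have "of_int D < (0 :: real)" using False D_nonzero by simp
      moreover have "v * v \<ge> 0" by simp
      ultimately show False using v by linarith
    qed
    thus ?thesis using False by (auto simp: totally_positive_def)
  next
    case Dpos: True
    define s where "s = sqrt (of_int D)"
    have ss: "s * s = of_int D" using Dpos by (simp add: s_def)
    define u where "u = of_rat p + of_rat q * s"
    define v where "v = of_rat p - of_rat q * s"
    have uv: "u * v = of_rat (nm x)" "u + v = of_rat (tr x)"
    proof -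
      have "u * v = of_rat p * of_rat p - of_rat q * of_rat q * (s * s)"
        by (simp add: u_def v_def algebra_simps)
      thus "u * v = of_rat (nm x)" unfolding ss by (simp add: x of_rat_diff of_rat_mult power2_eq_square)
    qed (simp add: u_def v_def x of_rat_mult)
    have "(\<forall>\<sigma>\<in>ring_hom (ring_on K) (ring_on (UNIV :: real set)). \<sigma> x > 0) \<longleftrightarrow> u > 0 \<and> v > 0"
    proof
      assume a: "\<forall>\<sigma>\<in>ring_hom (ring_on K) (ring_on (UNIV :: real set)). \<sigma> x > 0"
      show "u > 0 \<and> v > 0"
        using bspec[OF a ring_hom_K_exists[of s]] bspec[OF a ring_hom_K_exists[of "- s"]] ss
        by (simp add: x u_def v_def)
    next
      assume uvpos: "u > 0 \<and> v > 0"
      show "\<forall>\<sigma>\<in>ring_hom (ring_on K) (ring_on (UNIV :: real set)). \<sigma> x > 0"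
      proof
        fix \<sigma> assume "\<sigma> \<in> ring_hom (ring_on K) (ring_on (UNIV :: real set))"
        then obtain t where t: "t * t = of_int D" "\<sigma> x = of_rat p + of_rat q * t"
          using ring_hom_K_elt x by blast
        have "t = s \<or> t = - s" using t(1) ss by (metis square_eq_iff)
        thus "\<sigma> x > 0" using uvpos t(2) by (auto simp: u_def v_def)
      qed
    qed
    also have "\<dots> \<longleftrightarrow> u * v > 0 \<and> u + v > 0" by (auto simp: zero_less_mult_iff)
    also have "\<dots> \<longleftrightarrow> nm x > 0 \<and> tr x > 0" unfolding uv by simp
    finally show ?thesis using True Dpos by (auto simp: totally_positive_def)
  qed
qed (auto simp: totally_positive_def)

lemma tp_K: "totally_positive D x \<Longrightarrow> x \<in> K" and tp_nonzero: "totally_positive D x \<Longrightarrow> x \<noteq> 0"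
  by (auto simp: totally_positive_def)

lemma nm_pos_if_D_neg: "D < 0 \<Longrightarrow> x \<in> K \<Longrightarrow> x \<noteq> 0 \<Longrightarrow> nm x > 0"
proof -
  assume D: "D < 0" and x: "x \<in> K" "x \<noteq> 0"
  obtain p q where pq: "x = elt p q" using x K_cases by blast
  have "of_int D * q ^ 2 \<le> 0" using D by (simp add: mult_nonpos_nonneg)
  hence "nm x \<ge> 0" unfolding pq nm_elt using zero_le_power2[of p] by linarith
  thus ?thesis using x nm_eq_0_iff[of x] by simp
qed

lemma tp_nm_pos: "totally_positive D x \<Longrightarrow> nm x > 0"
  using nm_pos_if_D_neg D_nonzero by (cases "D > 0") (auto simp: totally_positive_iff)

lemma tp_mult: "totally_positive D x \<Longrightarrow> totally_positive D y \<Longrightarrow> totally_positive D (x * y)"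
  unfolding totally_positive_def by (simp add: ring_hom_K)

lemma tr_of_rat_mult: "x \<in> K \<Longrightarrow> tr (of_rat r * x) = r * tr x"
  by (auto simp: of_rat_eq_elt elt_mult elim!: K_cases)

lemma tp_inverse: assumes "totally_positive D x" shows "totally_positive D (inverse x)"
proof -
  have x: "x \<in> K" "x \<noteq> 0" "nm x > 0" using assms tp_K tp_nonzero tp_nm_pos by auto
  have "tr (inverse x) = inverse (nm x) * tr x"
    using x by (simp add: inverse_eq_cj tr_of_rat_mult)
  thus ?thesis using assms x by (auto simp: totally_positive_iff nm_inverse)
qed

lemma tp_of_rat: "r > 0 \<Longrightarrow> totally_positive D (of_rat r)"
  by (auto simp: totally_positive_iff) (simp add: of_rat_eq_elt)

text \<open>For \<open>D > 0\<close> a positive norm excludes a vanishing rational coordinate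
  \<open>p\<close>, since the norm would then be \<open>- D * q ^ 2\<close>. So the trace is nonzero
  and a sign makes it positive.\<close>

lemma tp_or_minus:
  assumes "x \<in> K" "nm x > 0"
  shows "totally_positive D x \<or> totally_positive D (- x)"
proof -
  have x0: "x \<noteq> 0" using assms by auto
  obtain p q where pq: "x = elt p q" using assms K_cases by blast
  have "p \<noteq> 0" if "D > 0"
  proof
    assume "p = 0"
    hence "of_int D * q ^ 2 < 0" using assms pq by simp
    thus False using that by (simp add: mult_less_0_iff)
  qed
  thus ?thesis using assms x0 unfolding totally_positive_iff
    by (auto simp: pq elt_minus) (auto simp: elt_eq_0_iff)
qed

lemma principal_minus: "principal (- x) = principal x"
proof -
  have "principal (- x) \<subseteq> principal x" for x
  proof
    fix z assume "z \<in> principal (- x)"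
    then obtain y where "y \<in> OK" "z = x * (- y)" by (auto simp: principal_def)
    thus "z \<in> principal x" unfolding principal_def using OK_minus by blast
  qed
  from this[of x] this[of "- x"] show ?thesis by simp
qed

section \<open>The narrow class group\<close>

abbreviation NP :: "complex set set" where "NP \<equiv> narrow_principal D"

lemma NP_eq: "NP = {principal x | x. totally_positive D x}"
  by (simp add: narrow_principal_def principal_def)

lemma principal_in_NP: "totally_positive D x \<Longrightarrow> principal x \<in> NP"
  by (auto simp: NP_eq)

lemma NP_subgroup: "subgroup NP (ideal_group D)"
proof (rule IG.subgroupI)
  show "NP \<subseteq> carrier (ideal_group D)" by (auto simp: NP_eq FI_principal tp_K tp_nonzero)
  show "NP \<noteq> {}" using principal_in_NP[OF tp_of_rat[of 1]] by auto
next
  fix I assume "I \<in> NP"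
  then obtain x where x: "I = principal x" "totally_positive D x" by (auto simp: NP_eq)
  have "principal (inverse x) \<star> principal x = OK" using x by (simp add: principal_principal tp_K tp_nonzero principal_1)
  hence "inv\<^bsub>ideal_group D\<^esub> I = principal (inverse x)"
    using x by (intro IG.inv_equality) (auto simp: FI_principal tp_K tp_nonzero)
  thus "inv\<^bsub>ideal_group D\<^esub> I \<in> NP" using x by (simp add: principal_in_NP tp_inverse)
next
  fix I J assume "I \<in> NP" "J \<in> NP"
  then obtain x y where xy: "I = principal x" "J = principal y" "totally_positive D x" "totally_positive D y"
    by (auto simp: NP_eq)
  hence "I \<star> J = principal (x * y)" by (simp add: principal_principal tp_K tp_nonzero)
  thus "I \<otimes>\<^bsub>ideal_group D\<^esub> J \<in> NP" using xy by (simp add: principal_in_NP tp_mult)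
qed

sublocale NPn: normal NP "ideal_group D"
  by (intro IG.subgroup_imp_normal NP_subgroup)

abbreviation Cl :: "complex set set monoid" where "Cl \<equiv> narrow_class_group D"
abbreviation ncl :: "complex set \<Rightarrow> complex set set" where "ncl \<equiv> narrow_class D"

sublocale CG: comm_group Cl
  unfolding narrow_class_group_def by (rule IG.abelian_FactGroup[OF NP_subgroup])

lemma carrier_Cl: "carrier Cl = ncl ` {J. FI J}"
  by (simp add: narrow_class_group_def narrow_class_def carrier_FactGroup)

lemma one_Cl: "\<one>\<^bsub>Cl\<^esub> = NP"
  by (simp add: narrow_class_group_def)

lemma ncl_mult: "FI I \<Longrightarrow> FI J \<Longrightarrow> ncl I \<otimes>\<^bsub>Cl\<^esub> ncl J = ncl (I \<star> J)"
  using NPn.rcos_sum[of I J] by (simp add: narrow_class_group_def narrow_class_def)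

lemma ncl_eq_one_iff: assumes "FI J" shows "ncl J = \<one>\<^bsub>Cl\<^esub> \<longleftrightarrow> (\<exists>x. totally_positive D x \<and> J = principal x)"
proof -
  have "ncl J = \<one>\<^bsub>Cl\<^esub> \<longleftrightarrow> J \<in> NP"
    unfolding one_Cl narrow_class_def
    using IG.coset_join1[of NP J] IG.coset_join2[of J NP] assms NP_subgroup by auto
  thus ?thesis by (auto simp: NP_eq)
qed

lemma ncl_principal_imul: assumes "FI J" "totally_positive D x" shows "ncl (principal x \<star> J) = ncl J"
proof -
  have principal: "FI (principal x)" using assms by (simp add: FI_principal tp_K tp_nonzero)
  have "ncl (principal x) = \<one>\<^bsub>Cl\<^esub>" using ncl_eq_one_iff[OF principal] assms by auto
  moreover have "ncl J \<in> carrier Cl" using assms by (auto simp: carrier_Cl)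
  ultimately show ?thesis using ncl_mult[OF principal assms(1)] CG.l_one by simp
qed

section \<open>Ambiguous ideals\<close>

lemma OK_cases [elim?]:
  assumes "x \<in> OK"
  obtains i j where "x = of_int i + of_int j * \<omega>"
  using assms by (auto simp: OK_eq)

definition sqf_divisor :: "int \<Rightarrow> bool" where
  "sqf_divisor a \<longleftrightarrow> a > 0 \<and> squarefree a \<and> a dvd D"

text \<open>The product of the ramified primes over the primes dividing \<open>a\<close>: each of them has residue degree
  one and is the only prime over its prime number, so membership is detected by the norm.\<close>

definition ambig :: "int \<Rightarrow> complex set" where
  "ambig a = {x \<in> OK. \<exists>k. nm x = of_int (a * k)}"

lemma ambig_OK: "x \<in> ambig a \<Longrightarrow> x \<in> OK" by (simp add: ambig_def)
lemma ambig_K: "x \<in> ambig a \<Longrightarrow> x \<in> K" by (simp add: ambig_def)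

lemma coord_in_ambig_iff: "of_int i + of_int j * \<omega> \<in> ambig a \<longleftrightarrow> a dvd i ^ 2 + D * i * j + N\<omega> * j ^ 2"
proof -
  have "of_int i + of_int j * \<omega> \<in> OK" by (auto simp: OK_eq)
  thus ?thesis unfolding ambig_def mem_Collect_eq nm_coord of_int_eq_iff dvd_def by blast
qed

text \<open>This is the discriminant of the characteristic polynomial of
  \<open>i + j * \<omega>\<close>. For \<open>j = 1\<close> it supplies the pair \<open>T\<close>,
  \<open>N\<close> needed in \<open>fundamental_discriminant\<close>.\<close>

lemma tr_nm_coord: "(2 * i + D * j) ^ 2 - 4 * (i ^ 2 + D * i * j + N\<omega> * j ^ 2) = D * j ^ 2"
proof -
  have "(2 * i + D * j) ^ 2 - 4 * (i ^ 2 + D * i * j + N\<omega> * j ^ 2) = D * D * j ^ 2 - (4 * N\<omega>) * j ^ 2"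
    by (simp add: power2_eq_square algebra_simps)
  thus ?thesis unfolding N\<omega> by (simp add: algebra_simps)
qed

text \<open>Here ramification enters: \<open>a\<close> divides both \<open>D\<close> and the norm,
  so by \<open>tr_nm_coord\<close> it divides the square of the trace, and being squarefree also the
  trace itself.\<close>

lemma tr_ambig: assumes "sqf_divisor a" "x \<in> ambig a" shows "\<exists>l. tr x = of_int (a * l)"
proof -
  obtain i j where x: "x = of_int i + of_int j * \<omega>" using assms OK_cases ambig_OK by metis
  have "a dvd i ^ 2 + D * i * j + N\<omega> * j ^ 2" using assms(2) unfolding x coord_in_ambig_iff .
  moreover have "a dvd D * j ^ 2" using assms(1) by (simp add: sqf_divisor_def)
  ultimately have "a dvd (2 * i + D * j) ^ 2"
    using tr_nm_coord[of i j] by (metis diff_add_cancel dvd_add dvd_mult)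
  hence "a dvd 2 * i + D * j" using assms(1) squarefree_dvd_square_imp_dvd by (simp add: sqf_divisor_def)
  thus ?thesis unfolding x tr_coord by (auto simp: dvd_def simp del: of_int_mult of_int_add)
qed

lemma ambig_mult: assumes "c \<in> OK" "x \<in> ambig a" shows "c * x \<in> ambig a"
proof -
  obtain n where n: "nm c = of_int n" using assms nm_of_OK by blast
  obtain k where k: "nm x = of_int (a * k)" using assms by (auto simp: ambig_def)
  have "nm (c * x) = of_int (a * (n * k))" using assms ambig_K by (simp add: nm_mult n k)
  moreover have "c * x \<in> OK" using assms ambig_OK by blast
  ultimately show ?thesis unfolding ambig_def by blast
qed

lemma ambig_cj: "x \<in> ambig a \<Longrightarrow> cj x \<in> ambig a"
  by (auto simp: ambig_def)

lemma cj_ambig: "cj ` ambig a = ambig a"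
proof
  show "ambig a \<subseteq> cj ` ambig a" using ambig_cj cj_cj ambig_K by (metis image_eqI subsetI)
qed (auto simp: ambig_cj)

text \<open>The norm is additive up to \<open>tr (x * cj y)\<close>, and \<open>x * cj y\<close>
  again lies in \<open>ambig a\<close>, so \<open>tr_ambig\<close> makes the cross term divisible by
  \<open>a\<close>.\<close>

lemma ambig_add: assumes "sqf_divisor a" "x \<in> ambig a" "y \<in> ambig a" shows "x + y \<in> ambig a"
proof -
  have "x * cj y \<in> ambig a" using ambig_mult[OF OK_cj[OF ambig_OK[OF assms(3)]] assms(2)] by (simp add: mult.commute)
  then obtain l where l: "tr (x * cj y) = of_int (a * l)" using tr_ambig assms by blast
  obtain k k' where "nm x = of_int (a * k)" "nm y = of_int (a * k')" using assms by (auto simp: ambig_def)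
  hence "nm (x + y) = of_int (a * (k + k' + l))"
    using ambig_K assms l by (simp add: nm_add algebra_simps)
  moreover have "x + y \<in> OK" using assms ambig_OK by blast
  ultimately show ?thesis unfolding ambig_def by blast
qed

lemma of_int_in_ambig_iff: assumes "sqf_divisor a" shows "of_int c \<in> ambig a \<longleftrightarrow> a dvd c"
proof -
  have "of_int c \<in> ambig a \<longleftrightarrow> a dvd c ^ 2" using coord_in_ambig_iff[of c 0 a] by simp
  also have "\<dots> \<longleftrightarrow> a dvd c"
    using assms squarefree_dvd_square_imp_dvd[of a c] unfolding sqf_divisor_def
    by (metis dvd_mult power2_eq_square)
  finally show ?thesis .
qed

lemma FI_ambig: assumes "sqf_divisor a" shows "FI (ambig a)"
proof (rule FI_I)
  show "\<exists>x\<in>ambig a. x \<noteq> 0" using of_int_in_ambig_iff[OF assms, of a] assms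
    by (intro bexI[of _ "of_int a"]) (auto simp: sqf_divisor_def)
  show "(1::int) > 0" by simp
qed (use assms in \<open>auto simp: ambig_K ambig_OK ambig_add ambig_mult\<close>)

text \<open>Supplies the second vector of a \<int>-basis of \<open>ambig a\<close>, next to
  \<open>a\<close>. For odd \<open>a\<close> the shift 0 works: \<open>a\<close> divides
  \<open>4 * N\<omega>\<close> and is coprime to 4.\<close>

lemma ambig_exists_shift: assumes "sqf_divisor a" shows "\<exists>t. of_int t + \<omega> \<in> ambig a"
proof -
  have "\<exists>t. a dvd t ^ 2 + D * t + N\<omega>"
  proof (cases "odd a")
    case True
    have "a dvd 4 * N\<omega>" unfolding N\<omega> using assms by (simp add: sqf_divisor_def)
    moreover have "coprime a 4"
      using True by (metis coprime_power_right_iff coprime_right_2_iff_odd mult_2 numeral_Bit0 power2_eq_square)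
    ultimately have "a dvd N\<omega>" by (simp add: coprime_dvd_mult_right_iff)
    thus ?thesis by (intro exI[of _ 0]) simp
  next
    case False
    then obtain a' where a': "a = 2 * a'" by auto
    have "odd a'"
    proof
      assume "even a'"
      then obtain b where "a = 2 ^ 2 * b" using a' by auto
      hence "2 ^ 2 dvd a" by simp
      hence "is_unit (2 :: int)" using assms unfolding sqf_divisor_def squarefree_def by blast
      thus False by simp
    qed
    have "even D" using assms False by (auto simp: sqf_divisor_def)
    hence D4: "D = 4 * d" using D_cases by presburger
    have "a dvd D" using assms by (simp add: sqf_divisor_def)
    hence "2 * a' dvd 2 * (2 * d)" unfolding a' D4 by simp
    hence "a' dvd 2 * d" unfolding dvd_mult_cancel_left by simp
    hence a'd: "a' dvd d" using \<open>odd a'\<close> by (simp add: coprime_dvd_mult_right_iff)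
    have "D * D - D = 4 * (4 * d * d - d)" unfolding D4 by (simp add: algebra_simps)
    hence "4 * N\<omega> = 4 * (4 * d * d - d)" by (simp only: N\<omega>)
    hence N: "N\<omega> = 4 * d * d - d" by simp
    \<comment> \<open>For \<open>a = 2 * a'\<close> the shift must be divisible by \<open>a'\<close>
      and have the parity of \<open>d\<close>, because \<open>N\<omega> = 4 * d * d - d\<close>. As
      \<open>a'\<close> is odd, \<open>a' * d\<close> meets both demands.\<close>
    define M where "M = (a' * d) ^ 2 + D * (a' * d) + N\<omega>"
    have "a' dvd M" unfolding M_def N unfolding D4 using a'd
      by (intro dvd_add dvd_diff) (auto simp: power2_eq_square)
    moreover have "even M" unfolding M_def N unfolding D4 using \<open>odd a'\<close> by simp
    moreover have "coprime 2 a'" using \<open>odd a'\<close> by simp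
    ultimately have "a dvd M" unfolding a' by (simp add: divides_mult)
    thus ?thesis unfolding M_def by blast
  qed
  thus ?thesis using coord_in_ambig_iff[of _ 1 a] by simp
qed

text \<open>Subtracting \<open>j * (t + \<omega>)\<close> leaves the integer
  \<open>i - t * j\<close>. Hence \<open>a\<close> and \<open>t + \<omega>\<close> form a
  \<int>-basis of \<open>ambig a\<close>.\<close>

lemma ambig_coord:
  assumes "sqf_divisor a" "of_int t + \<omega> \<in> ambig a"
  shows "of_int i + of_int j * \<omega> \<in> ambig a \<longleftrightarrow> a dvd i - t * j"
proof -
  have jt: "of_int j * (of_int t + \<omega>) \<in> ambig a" using assms by (intro ambig_mult) auto
  have eq: "of_int i + of_int j * \<omega> - of_int j * (of_int t + \<omega>) = of_int (i - t * j)"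
    by (simp add: algebra_simps)
  have "of_int i + of_int j * \<omega> \<in> ambig a \<longleftrightarrow> of_int (i - t * j) \<in> ambig a"
    using eq FI_diff[OF FI_ambig[OF assms(1)] _ jt] ambig_add[OF assms(1) _ jt]
    by (metis diff_add_cancel)
  thus ?thesis unfolding of_int_in_ambig_iff[OF assms(1)] .
qed

text \<open>The ideal is its own conjugate, so its square is generated by a positive rational
  \<open>g\<close>, and trace and norm of products show \<open>g = a * h\<close>. The square
  contains \<open>N\<close>, \<open>a * T\<close> and \<open>a * a\<close>, where \<open>T\<close>
  and \<open>N\<close> are trace and norm of \<open>t + \<omega>\<close>. So \<open>h\<close>
  divides \<open>T\<close> and \<open>a\<close>, whence \<open>h ^ 2\<close> divides
  \<open>a * h\<close> and with it \<open>N\<close>. Now \<open>fundamental_discriminant\<close>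
  gives \<open>h = 1\<close>.\<close>

lemma ambig_imul_ambig: assumes "sqf_divisor a" shows "ambig a \<star> ambig a = principal (of_int a)"
proof -
  have a0: "a > 0" using assms by (simp add: sqf_divisor_def)
  obtain g where g: "g > 0" "ambig a \<star> ambig a = principal (of_rat g)"
    using imul_cj_principal[OF FI_ambig[OF assms]] by (auto simp: cj_ambig)
  have self: "of_rat g \<in> principal (of_rat g)" by (auto simp: principal_def intro: image_eqI[of _ _ 1])
  have rat_mem: "r / g \<in> \<int>" if "of_rat r \<in> ambig a \<star> ambig a" for r
  proof -
    obtain y where y: "y \<in> OK" "of_rat r = of_rat g * y" using \<open>of_rat r \<in> ambig a \<star> ambig a\<close> g(2) by (auto simp: principal_def)
    hence "of_rat (r / g) = y" using g(1) by (simp add: of_rat_divide)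
    thus ?thesis using y of_rat_in_OK_iff by metis
  qed
  have "ambig a \<star> ambig a \<subseteq> principal (of_int a)"
  proof (rule imul_subset)
    fix x y assume xy: "x \<in> ambig a" "y \<in> ambig a"
    have "x * y \<in> ambig a" using ambig_mult[OF ambig_OK[OF xy(1)] xy(2)] .
    then obtain l where l: "tr (x * y) = of_int (a * l)" using tr_ambig assms by blast
    obtain k k' where k: "nm x = of_int (a * k)" "nm y = of_int (a * k')" using xy by (auto simp: ambig_def)
    define z where "z = of_rat (inverse (of_int a)) * (x * y)"
    have K: "x \<in> K" "y \<in> K" using xy ambig_K by auto
    have "tr z = of_int l" using a0 K by (simp add: z_def tr_of_rat_mult l)
    moreover have "nm z = of_int (k * k')" using a0 K
      by (simp add: z_def nm_mult k power2_eq_square field_simps)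
    moreover have "z \<in> K" using K by (simp add: z_def)
    ultimately have "z \<in> OK" by (simp add: OK_iff)
    moreover have "x * y = of_int a * z" using a0 by (simp add: z_def of_rat_inverse)
    ultimately show "x * y \<in> principal (of_int a)" by (auto simp: principal_def)
  next
    show "x + y \<in> principal (of_int a)" if "x \<in> principal (of_int a)" "y \<in> principal (of_int a)" for x y
      using FI_add[OF FI_principal that] a0 by auto
  qed
  hence "of_rat g \<in> principal (of_int a)" using self g by auto
  then obtain y where y: "y \<in> OK" "of_rat g = of_int a * y" by (auto simp: principal_def)
  hence "of_rat (g / of_int a) = y" using a0 by (simp add: of_rat_divide)
  hence "g / of_int a \<in> \<int>" using y of_rat_in_OK_iff by metis
  then obtain h where "g / of_int a = of_int h" by (auto elim: Ints_cases)
  hence gh: "g = of_int (a * h)" using a0 by (simp add: field_simps)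
  have h0: "h > 0" using g(1) a0 unfolding gh by (simp add: zero_less_mult_iff)
  obtain t where t: "of_int t + \<omega> \<in> ambig a" using ambig_exists_shift[OF assms] by blast
  define x where "x = of_int t + \<omega>"
  have x: "x \<in> ambig a" "x \<in> K" using t ambig_K by (auto simp: x_def)
  define T where "T = 2 * t + D"
  define N where "N = t ^ 2 + D * t + N\<omega>"
  have trx: "tr x = of_int T" and nmx: "nm x = of_int N"
    using tr_coord[of t 1] nm_coord[of t 1] by (simp_all add: x_def T_def N_def)
  have aA: "of_int a \<in> ambig a" using of_int_in_ambig_iff[OF assms] by simp
  have 1: "of_rat (nm x) \<in> ambig a \<star> ambig a"
    using imulI[OF x(1) ambig_cj[OF x(1)]] mult_cj[OF x(2)] by simp
  have 2: "of_rat (of_int a * tr x) \<in> ambig a \<star> ambig a"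
  proof -
    have "of_rat (of_int a * tr x) = of_int a * x + of_int a * cj x"
      using add_cj[OF x(2)] by (simp add: of_rat_mult flip: distrib_left)
    thus ?thesis using imulI[OF aA] x(1) ambig_cj by (metis imul_add)
  qed
  have 3: "of_rat (of_int (a * a)) \<in> ambig a \<star> ambig a" using imulI[OF aA aA]
    unfolding of_rat_of_int_eq by simp
  have dv: "a * h dvd c" if "of_rat (of_int c) \<in> ambig a \<star> ambig a" for c
  proof -
    obtain e where "of_int c / g = of_int e" using rat_mem[OF \<open>of_rat (of_int c) \<in> ambig a \<star> ambig a\<close>] by (auto elim: Ints_cases)
    hence "of_int c = of_int e * g" using g(1) by (simp add: field_simps)
    hence "(of_int c :: rat) = of_int (e * (a * h))" by (simp add: gh)
    hence "c = e * (a * h)" by (simp only: of_int_eq_iff)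
    thus ?thesis by simp
  qed
  have "a * h dvd N" using 1 dv by (simp add: nmx)
  moreover have "a * h dvd a * T" using 2 dv[of "a * T"] by (simp add: trx)
  hence "h dvd T" using a0 by simp
  moreover have "a * h dvd a * a" using 3 dv by blast
  hence "h dvd a" using a0 by simp
  hence "h * h dvd a * h" by simp
  ultimately have "h dvd T" "h ^ 2 dvd N" by (auto simp: power2_eq_square intro: dvd_trans)
  moreover have "T ^ 2 - 4 * N = D" using tr_nm_coord[of t 1] by (simp add: T_def N_def)
  ultimately have "h dvd 1" using fundamental_discriminant by blast
  hence "h = 1" using h0 by simp
  thus ?thesis using g gh by simp
qed

text \<open>Scale \<open>J\<close> so that its \<open>\<omega>\<close>-coordinates are exactly the integers. Then \<open>J\<close> is spanned over \<open>\<int>\<close> by an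
  integer \<open>n\<close> and some \<open>t + \<omega>\<close>; stability makes \<open>n\<close> divide the trace and the norm of \<open>t + \<omega>\<close>, so
  \<open>n\<close> divides \<open>D\<close>, and it is squarefree because \<open>D\<close> is fundamental.\<close>

lemma stable_ideal_eq:
  assumes J: "FI J" and st: "cj ` J = J"
  shows "\<exists>r>0. \<exists>n. sqf_divisor n \<and> J = (\<lambda>x. of_rat r * x) ` ambig n"
proof -
  define yc where "yc x = 2 * ip x" for x
  define xc where "xc x = rp x - of_int D * ip x" for x
  have coords: "x = of_rat (xc x) + of_rat (yc x) * \<omega>" if x: "x \<in> K" for x
  proof -
    obtain p q where "x = elt p q" using x K_cases by blast
    thus ?thesis by (simp add: rat_coord xc_def yc_def)
  qed
  have ycc: "yc (of_rat u + of_rat v * \<omega>) = v" "xc (of_rat u + of_rat v * \<omega>) = u" for u v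
    by (simp_all add: rat_coord xc_def yc_def)
  have yc_diff: "yc (x - y) = yc x - yc y" if "x \<in> K" "y \<in> K" for x y
    using that by (auto simp: yc_def elt_diff elim!: K_cases)
  have yc_mult: "yc (of_rat r * x) = r * yc x" if "x \<in> K" for x r
    using that by (auto simp: yc_def of_rat_eq_elt elt_mult elim!: K_cases)
  have yc_OK: "yc x \<in> \<int>" if "x \<in> OK" for x
  proof -
    obtain i j where x: "x = of_int i + of_int j * \<omega>" using OK_cases[OF \<open>x \<in> OK\<close>] .
    show ?thesis using ycc(1)[of "of_int i" "of_int j"] by (simp add: x)
  qed
  obtain m0 where m0: "m0 > 0" "\<And>x. x \<in> J \<Longrightarrow> of_int m0 * x \<in> OK" using FI_denominator[OF J] by blast
  have "\<exists>g>0. yc ` J = {of_int k * g | k. True}"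
  proof (rule rat_subgroup_cyclic)
    show "x - y \<in> yc ` J" if "x \<in> yc ` J" "y \<in> yc ` J" for x y
      using that FI_K[OF J] FI_diff[OF J] by (auto simp flip: yc_diff)
    show "of_int m0 * y \<in> \<int>" if "y \<in> yc ` J" for y
    proof -
      obtain x where x: "x \<in> J" "y = yc x" using \<open>y \<in> yc ` J\<close> by auto
      have "yc (of_rat (of_int m0) * x) \<in> \<int>" using yc_OK[OF m0(2)[OF x(1)]] by simp
      thus ?thesis using x FI_K[OF J] by (simp only: yc_mult)
    qed
    obtain x where x: "x \<in> J" "x \<noteq> 0" using FI_nonzero[OF J] by blast
    hence xK: "x \<in> K" using FI_K[OF J] by auto
    show "\<exists>y\<in>yc ` J. y \<noteq> 0"
    \<comment> \<open>If the \<omega>-coordinate of \<open>x\<close> vanishes, then \<open>x\<close>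
      is rational and \<open>\<omega> * x\<close> has \<omega>-coordinate \<open>x\<close>.\<close>
    proof (cases "yc x = 0")
      case True
      hence x': "x = of_rat (xc x)" using coords[OF xK] by simp
      have "yc (\<omega> * x) = xc x" using ycc(1)[of 0 "xc x"] x' by (simp add: mult.commute)
      moreover have "xc x \<noteq> 0" using x' x(2) by auto
      moreover have "\<omega> * x \<in> J" using FI_mult[OF J] x by simp
      ultimately show ?thesis by (metis image_eqI)
    qed (use x in auto)
  qed (rule m0)
  then obtain m where m: "m > 0" "yc ` J = {of_int k * m | k. True}" by blast
  define J0 where "J0 = (\<lambda>x. of_rat (inverse m) * x) ` J"
  have J0P: "J0 = principal (of_rat (inverse m)) \<star> J" unfolding J0_def by (rule principal_imul[symmetric]) (auto simp: J)
  have J0: "FI J0" unfolding J0P using m by (intro FI_imul FI_principal J) auto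
  have JJ0: "J = (\<lambda>x. of_rat m * x) ` J0"
    unfolding J0_def image_image using m(1) by (simp add: of_rat_inverse flip: mult.assoc)
  have st0: "cj x \<in> J0" if "x \<in> J0" for x
  proof -
    obtain y where y: "y \<in> J" "x = of_rat (inverse m) * y" using \<open>x \<in> J0\<close> by (auto simp: J0_def)
    have "cj x = of_rat (inverse m) * cj y" using y FI_K[OF J] by (simp add: cj_mult)
    moreover have "cj y \<in> J" using y st by auto
    ultimately show ?thesis by (auto simp: J0_def)
  qed
  have yc0: "yc x \<in> \<int>" if "x \<in> J0" for x
  proof -
    obtain y where y: "y \<in> J" "x = of_rat (inverse m) * y" using \<open>x \<in> J0\<close> by (auto simp: J0_def)
    obtain k where k: "yc y = of_int k * m" using y m(2) by auto
    have "yc x = inverse m * (of_int k * m)" using y FI_K[OF J] k by (simp add: yc_mult)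
    also have "\<dots> = of_int k" using m(1) by (simp add: field_simps)
    finally show ?thesis by simp
  qed
  have "m \<in> yc ` J" unfolding m(2) by (auto intro: exI[of _ 1])
  then obtain y0 where y0: "y0 \<in> J" "yc y0 = m" by auto
  define x0 where "x0 = of_rat (inverse m) * y0"
  have x0: "x0 \<in> J0" "yc x0 = 1" "x0 \<in> K"
    using y0 m(1) FI_K[OF J] by (auto simp: x0_def J0_def yc_mult)
  define S where "S = {r. of_rat r \<in> J0}"
  obtain m1 where m1: "m1 > 0" "\<And>x. x \<in> J0 \<Longrightarrow> of_int m1 * x \<in> OK" using FI_denominator[OF J0] by blast
  have "\<exists>g>0. S = {of_int k * g | k. True}"
  proof (rule rat_subgroup_cyclic)
    show "x - y \<in> S" if "x \<in> S" "y \<in> S" for x y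
      using that FI_diff[OF J0] by (simp add: S_def of_rat_diff)
    show "of_int m1 * x \<in> \<int>" if "x \<in> S" for x
    proof -
      have "of_rat (of_int m1 * x) \<in> OK" using \<open>x \<in> S\<close> m1(2) by (simp add: S_def of_rat_mult)
      thus ?thesis by (simp only: of_rat_in_OK_iff)
    qed
    \<comment> \<open>Since \<open>m1\<close> clears the denominator of \<open>x0\<close>, the
      multiplier is integral, and a nonzero rational element of \<open>J0\<close> results.\<close>
    have "cj (of_int m1 * x0) * x0 \<in> J0" using FI_mult[OF J0] m1 x0 by auto
    moreover have "cj (of_int m1 * x0) * x0 = of_rat (of_int m1 * nm x0)"
      using mult_cj[OF x0(3)] x0(3) by (simp add: cj_mult of_rat_mult mult_ac)
    ultimately have "of_int m1 * nm x0 \<in> S" by (simp add: S_def)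
    moreover have "of_int m1 * nm x0 \<noteq> 0" 
    proof -
      have "yc 0 = 0" using ycc(1)[of 0 0] by simp
      hence "x0 \<noteq> 0" using x0(2) by auto
      thus ?thesis using m1 nm_eq_0_iff[OF x0(3)] by simp
    qed
    ultimately show "\<exists>x\<in>S. x \<noteq> 0" by blast
  qed (rule m1)
  then obtain g where g: "g > 0" "S = {of_int k * g | k. True}" by blast
  have gJ: "of_rat g \<in> J0" using g(2) by (auto simp: S_def intro: exI[of _ 1])
  \<comment> \<open>The \<omega>-coordinate of \<open>\<omega> * g\<close> is \<open>g\<close>, and
    \<omega>-coordinates on \<open>J0\<close> are integers. The same device applied to
    \<open>\<omega> * x0\<close> shows below that \<open>u\<close> is an integer.\<close>
  have "g \<in> \<int>"
  proof -
    have "\<omega> * of_rat g \<in> J0" using FI_mult[OF J0 _ gJ] by simp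
    hence "yc (\<omega> * of_rat g) \<in> \<int>" by (rule yc0)
    thus ?thesis using ycc(1)[of 0 g] by (simp add: mult.commute)
  qed
  then obtain n where n: "g = of_int n" by (auto elim: Ints_cases)
  have n0: "n > 0" using g n by simp
  define u where "u = xc x0"
  have x0u: "x0 = of_rat u + \<omega>" using coords[OF x0(3)] x0(2) by (simp add: u_def)
  have "u \<in> \<int>"
  proof -
    have "\<omega> * x0 = of_rat (- of_int N\<omega>) + of_rat (u + of_int D) * \<omega>"
      unfolding x0u using \<omega>_square by (simp add: algebra_simps of_rat_add of_rat_minus)
    hence "yc (\<omega> * x0) = u + of_int D" by (simp only: ycc)
    moreover have "yc (\<omega> * x0) \<in> \<int>" using FI_mult[OF J0 _ x0(1)] by (intro yc0) simp
    ultimately show ?thesis by (metis Ints_diff Ints_of_int add_diff_cancel_right')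
  qed
  then obtain t where t: "u = of_int t" by (auto elim: Ints_cases)
  have x0t: "x0 = of_int t + \<omega>" by (simp add: x0u t)
  define T where "T = 2 * t + D"
  define N where "N = t ^ 2 + D * t + N\<omega>"
  have trx: "tr x0 = of_int T" and nmx: "nm x0 = of_int N"
    using tr_coord[of t 1] nm_coord[of t 1] by (simp_all add: x0t T_def N_def)
  have x0OK: "x0 \<in> OK" using x0 by (simp add: OK_iff trx nmx)
  have int_mem: "of_int c \<in> J0 \<longleftrightarrow> n dvd c" for c
  proof -
    have "of_int c \<in> J0 \<longleftrightarrow> of_int c \<in> S" by (simp add: S_def)
    also have "\<dots> \<longleftrightarrow> (\<exists>k. (of_int c :: rat) = of_int (k * n))" unfolding g(2) n by simp
    also have "\<dots> \<longleftrightarrow> n dvd c" by (auto simp: dvd_def mult.commute simp del: of_int_mult)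
    finally show ?thesis .
  qed
  have "of_int T = x0 + cj x0" using add_cj[OF x0(3)] by (simp add: trx)
  hence nT: "n dvd T" using FI_add[OF J0 x0(1) st0[OF x0(1)]] int_mem by metis
  have "of_int N = cj x0 * x0" using mult_cj[OF x0(3)] by (simp add: nmx mult.commute)
  hence nN: "n dvd N" using FI_mult[OF J0 OK_cj[OF x0OK] x0(1)] int_mem by metis
  have TN: "T ^ 2 - 4 * N = D" using tr_nm_coord[of t 1] by (simp add: T_def N_def)
  have "n dvd D"
  proof -
    have "n dvd T ^ 2" using nT by (simp add: power2_eq_square)
    moreover have "n dvd 4 * N" using nN by simp
    ultimately show ?thesis using TN dvd_diff by metis
  qed
  moreover have "squarefree n" unfolding squarefree_def
  proof (intro allI impI)
    fix h assume h: "h ^ 2 dvd n"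
    have "h ^ 2 dvd N" using h nN dvd_trans by blast
    moreover have "h dvd T" using h nT by (metis dvd_trans dvd_triv_left power2_eq_square)
    ultimately show "h dvd 1" using fundamental_discriminant TN by blast
  qed
  ultimately have sqf_divisor: "sqf_divisor n" using n0 by (simp add: sqf_divisor_def)
  have x0A: "of_int t + \<omega> \<in> ambig n" using x0OK nN nmx unfolding x0t by (auto simp: ambig_def dvd_def)
  have "J0 = ambig n"
  proof (rule equalityI; rule subsetI)
    fix x assume x: "x \<in> J0"
    obtain j where j: "yc x = of_int j" using yc0[OF x] by (auto elim: Ints_cases)
    have "x - of_int j * x0 \<in> J0" by (intro FI_diff[OF J0] x FI_mult_int[OF J0] x0)
    moreover have eq: "x - of_int j * x0 = of_rat (xc x - of_int j * of_int t)"
      using coords[of x] x FI_K[OF J0] by (simp add: j x0t algebra_simps of_rat_diff of_rat_mult)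
    ultimately have "xc x - of_int j * of_int t \<in> S" by (simp add: S_def)
    then obtain k where k: "xc x - of_int j * of_int t = of_int (k * n)" unfolding g(2) n by auto
    hence "x - of_int j * x0 = of_int (k * n)" using eq by (simp only: of_rat_of_int_eq)
    hence "x = of_int (k * n) + of_int j * (of_int t + \<omega>)" by (simp add: x0t algebra_simps)
    moreover have "of_int (k * n) \<in> ambig n" unfolding of_int_in_ambig_iff[OF sqf_divisor] by simp
    ultimately show "x \<in> ambig n" using ambig_add[OF sqf_divisor] ambig_mult[OF OK_of_int x0A] by blast
  next
    fix x assume x: "x \<in> ambig n"
    then obtain i j where ij: "x = of_int i + of_int j * \<omega>" using OK_cases ambig_OK by metis
    hence "n dvd i - t * j" using x ambig_coord[OF sqf_divisor x0A] by simp
    hence "of_int (i - t * j) \<in> J0" by (simp only: int_mem)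
    moreover have "x = of_int (i - t * j) + of_int j * x0" by (simp add: ij x0t algebra_simps)
    ultimately show "x \<in> J0" using FI_add[OF J0] FI_mult_int[OF J0 x0(1)] by metis
  qed
  thus ?thesis using JJ0 m(1) sqf_divisor by blast
qed

section \<open>Indices of stable ideals and the ambiguous ideal of given norm\<close>

lemma coord_inject: "of_int i + of_int j * \<omega> = of_int i' + of_int j' * \<omega> \<longleftrightarrow> i = i' \<and> j = j'"
  by (auto simp: int_coord elt_inject)

lemma ring_OK: "ring (ring_on OK)"
proof (rule ringI)
  show "abelian_group (ring_on OK)"
  proof (rule abelian_groupI)
    show "\<exists>y\<in>carrier (ring_on OK). y \<oplus>\<^bsub>ring_on OK\<^esub> x = \<zero>\<^bsub>ring_on OK\<^esub>" if "x \<in> carrier (ring_on OK)" for x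
      using that by (intro bexI[of _ "- x"]) (auto simp: ring_on_def)
  qed (auto simp: ring_on_def)
  show "monoid (ring_on OK)" by (rule monoidI) (auto simp: ring_on_def)
qed (auto simp: ring_on_def algebra_simps)

definition coset :: "complex set \<Rightarrow> complex \<Rightarrow> complex set" where
  "coset I x = (\<lambda>y. y + x) ` I"

lemma order_Quot: "Coset.order (ring_on OK Quot I) = card (coset I ` OK)"
proof -
  have "carrier (ring_on OK Quot I) = coset I ` OK"
    unfolding FactRing_def A_RCOSETS_def' coset_def a_r_coset_def' by (auto simp: ring_on_def)
  thus ?thesis by (simp add: Coset.order_def)
qed

lemma coset_eq_iff:
  assumes "\<And>x y. x \<in> I \<Longrightarrow> y \<in> I \<Longrightarrow> x - y \<in> I" "0 \<in> I"
  shows "coset I x = coset I y \<longleftrightarrow> x - y \<in> I"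
proof
  assume eq: "coset I x = coset I y"
  have "x \<in> coset I x" using assms(2) by (auto simp: coset_def intro: image_eqI[of _ _ 0])
  hence "x \<in> coset I y" using eq by simp
  thus "x - y \<in> I" by (auto simp: coset_def)
next
  assume xy: "x - y \<in> I"
  have neg: "- z \<in> I" if "z \<in> I" for z using assms(1)[OF assms(2) that] by simp
  have add: "z + z' \<in> I" if "z \<in> I" "z' \<in> I" for z z' using assms(1)[OF that(1) neg[OF that(2)]] by simp
  have sub: "coset I x \<subseteq> coset I y" if "x - y \<in> I" for x y
  proof
    fix v assume "v \<in> coset I x"
    then obtain z where z: "z \<in> I" "v = z + x" by (auto simp: coset_def)
    hence "v = (z + (x - y)) + y" "z + (x - y) \<in> I" using add \<open>x - y \<in> I\<close> by auto
    thus "v \<in> coset I y" unfolding coset_def by blast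
  qed
  show "coset I x = coset I y" using sub[OF xy] sub[of y x] neg[OF xy] by auto
qed

text \<open>The scaled ideal has the \<int>-basis \<open>m * n\<close>,
  \<open>m * (t + \<omega>)\<close>, so the pairs \<open>(i, j)\<close> with
  \<open>0 \<le> i < m * n\<close> and \<open>0 \<le> j < m\<close> represent each residue class
  exactly once.\<close>

lemma index_scaled_ambig:
  assumes "sqf_divisor n" "m > 0"
  shows "Coset.order (ring_on OK Quot ((\<lambda>x. of_int m * x) ` ambig n)) = nat (m * n * m)"
proof -
  define I where "I = (\<lambda>x. of_int m * x) ` ambig n"
  have n0: "n > 0" using assms by (simp add: sqf_divisor_def)
  obtain t where t: "of_int t + \<omega> \<in> ambig n" using ambig_exists_shift assms by blast
  have I_diff: "x - y \<in> I" if "x \<in> I" "y \<in> I" for x y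
    using that FI_diff[OF FI_ambig[OF assms(1)]] by (auto simp: I_def simp flip: right_diff_distrib)
  have I_0: "0 \<in> I" using FI_0[OF FI_ambig[OF assms(1)]] by (force simp: I_def)
  have mem: "of_int i + of_int j * \<omega> \<in> I \<longleftrightarrow> m dvd j \<and> m * n dvd i - t * j" for i j
  proof
    assume "of_int i + of_int j * \<omega> \<in> I"
    then obtain x where x: "x \<in> ambig n" "of_int i + of_int j * \<omega> = of_int m * x" by (auto simp: I_def)
    obtain i' j' where x': "x = of_int i' + of_int j' * \<omega>" using OK_cases ambig_OK x by metis
    have "of_int i + of_int j * \<omega> = of_int (m * i') + of_int (m * j') * \<omega>"
      using x x' by (simp add: algebra_simps)
    hence ij: "i = m * i'" "j = m * j'" by (simp_all only: coord_inject)
    have "n dvd i' - t * j'" using x x' ambig_coord[OF assms(1) t] by simp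
    moreover have "i - t * j = m * (i' - t * j')" by (simp add: ij algebra_simps)
    ultimately show "m dvd j \<and> m * n dvd i - t * j" using ij by auto
  next
    assume a: "m dvd j \<and> m * n dvd i - t * j"
    then obtain j' k where j': "j = m * j'" "i - t * j = m * n * k" by (auto elim!: dvdE)
    define i' where "i' = n * k + t * j'"
    have i': "i = m * i'" using j' by (simp add: i'_def algebra_simps)
    have "of_int i + of_int j * \<omega> = of_int m * (of_int i' + of_int j' * \<omega>)"
      unfolding i' j'(1) by (simp add: algebra_simps)
    moreover have "of_int i' + of_int j' * \<omega> \<in> ambig n"
      unfolding ambig_coord[OF assms(1) t] by (simp add: i'_def)
    ultimately show "of_int i + of_int j * \<omega> \<in> I" by (auto simp: I_def)
  qed
  have ceq: "coset I x = coset I y \<longleftrightarrow> x - y \<in> I" for x y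
    by (rule coset_eq_iff) (auto intro: I_diff I_0)
  define f where "f = (\<lambda>(i, j). coset I (of_int i + of_int j * \<omega>))"
  have f_eq: "f (i, j) = f (i', j') \<longleftrightarrow> m dvd j - j' \<and> m * n dvd (i - i') - t * (j - j')" for i j i' j'
  proof -
    have "of_int i + of_int j * \<omega> - (of_int i' + of_int j' * \<omega>) = of_int (i - i') + of_int (j - j') * \<omega>"
      by (simp add: algebra_simps)
    thus ?thesis unfolding f_def prod.case by (simp only: ceq mem)
  qed
  have "inj_on f ({0..<m * n} \<times> {0..<m})"
  proof (rule inj_onI, clarify)
    fix i j i' j' assume *: "f (i, j) = f (i', j')" "i \<in> {0..<m * n}" "j \<in> {0..<m}" "i' \<in> {0..<m * n}" "j' \<in> {0..<m}"
    have "m dvd j - j'" using * f_eq by blast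
    hence j: "j = j'" using *(3,5) by (metis atLeastLessThan_iff mod_eq_dvd_iff mod_pos_pos_trivial)
    hence "m * n dvd i - i'" using * f_eq by simp
    hence "i = i'" using *(2,4) by (metis atLeastLessThan_iff mod_eq_dvd_iff mod_pos_pos_trivial)
    thus "i = i' \<and> j = j'" using j by simp
  qed
  hence "card (f ` ({0..<m * n} \<times> {0..<m})) = card ({0..<m * n} \<times> {0..<m})" by (rule card_image)
  also have "\<dots> = nat (m * n * m)" using assms n0 by (simp add: card_cartesian_product nat_mult_distrib)
  also have "f ` ({0..<m * n} \<times> {0..<m}) = coset I ` OK"
  proof
    show "f ` ({0..<m * n} \<times> {0..<m}) \<subseteq> coset I ` OK" by (auto simp: f_def)
    show "coset I ` OK \<subseteq> f ` ({0..<m * n} \<times> {0..<m})"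
    proof
      fix c assume "c \<in> coset I ` OK"
      then obtain i j where "c = f (i, j)" unfolding f_def by (auto elim!: OK_cases)
      \<comment> \<open>The order matters: reducing \<open>j\<close> modulo \<open>m\<close> shifts
        the integer part by a multiple of \<open>t\<close>, and only the corrected value is reduced
        modulo \<open>m * n\<close>.\<close>
      moreover define j0 where "j0 = j mod m"
      moreover define i0 where "i0 = (i - t * (j - j0)) mod (m * n)"
      ultimately have c: "c = f (i, j)" and j0: "j0 = j mod m" and i0: "i0 = (i - t * (j - j0)) mod (m * n)"
        by auto
      have "m dvd j - j0" unfolding j0 by (simp add: minus_mod_eq_mult_div)
      moreover have "m * n dvd (i - t * (j - j0)) - i0" unfolding i0 by (simp add: minus_mod_eq_mult_div)
      hence "m * n dvd (i - i0) - t * (j - j0)" by (simp add: algebra_simps)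
      ultimately have "c = f (i0, j0)" unfolding c f_eq by simp
      moreover have "(i0, j0) \<in> {0..<m * n} \<times> {0..<m}" using assms n0 by (simp add: i0 j0)
      ultimately show "c \<in> f ` ({0..<m * n} \<times> {0..<m})" by blast
    qed
  qed
  finally show ?thesis by (simp add: order_Quot I_def)
qed

lemma ideal_ambig: assumes "sqf_divisor a" shows "ideal (ambig a) (ring_on OK)"
proof (rule idealI)
  interpret R: ring "ring_on OK" by (rule ring_OK)
  show "subgroup (ambig a) (add_monoid (ring_on OK))"
  proof (rule group.subgroupI[OF R.a_group])
    have inv: "\<ominus>\<^bsub>ring_on OK\<^esub> x = - x" if "x \<in> ambig a" for x
      by (rule R.minus_equality) (use that ambig_OK in \<open>auto simp: ring_on_def\<close>)
    show "inv\<^bsub>add_monoid (ring_on OK)\<^esub> x \<in> ambig a" if "x \<in> ambig a" for x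
      using inv[OF that] FI_minus[OF FI_ambig[OF assms] that] by (simp add: a_inv_def)
    show "ambig a \<noteq> {}" using FI_0[OF FI_ambig[OF assms]] by auto
  qed (use assms in \<open>auto simp: ring_on_def ambig_OK ambig_add\<close>)
  show "x \<otimes>\<^bsub>ring_on OK\<^esub> y \<in> ambig a" "y \<otimes>\<^bsub>ring_on OK\<^esub> x \<in> ambig a"
    if "y \<in> ambig a" "x \<in> carrier (ring_on OK)" for x y
    using that ambig_mult by (auto simp: ring_on_def mult.commute)
qed (rule ring_OK)

text \<open>Uniqueness comes from the index: a stable integral ideal is \<open>j\<close> times some
  \<open>ambig n\<close> and has index \<open>j ^ 2 * n\<close>. If this is squarefree, then
  \<open>j = 1\<close> and \<open>n\<close> is the index.\<close>

lemma ambiguous_ideal_eq: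
  assumes "sqf_divisor (int a)"
  shows "ambiguous_ideal D a = ambig (int a)"
  unfolding ambiguous_ideal_def
proof (rule the_equality)
  have "(\<lambda>x. of_int 1 * x) ` ambig (int a) = ambig (int a)" by simp
  hence "Coset.order (ring_on OK Quot ambig (int a)) = a"
    using index_scaled_ambig[OF assms, of 1] by simp
  moreover have "quad_conj D (ambig (int a)) = ambig (int a)"
    by (subst quad_conj_eq) (auto simp: ambig_K cj_ambig)
  ultimately show "ideal (ambig (int a)) (ring_on OK) \<and> quad_conj D (ambig (int a)) = ambig (int a) \<and>
      Coset.order (ring_on OK Quot ambig (int a)) = a" using ideal_ambig[OF assms] by simp
next
  fix I assume I: "ideal I (ring_on OK) \<and> quad_conj D I = I \<and> Coset.order (ring_on OK Quot I) = a"
  then interpret I: ideal I "ring_on OK" by simp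
  have sub: "I \<subseteq> OK" using I.a_subset by (simp add: ring_on_def)
  have a0: "a > 0" using assms by (simp add: sqf_divisor_def)
  have add: "x + y \<in> I" if "x \<in> I" "y \<in> I" for x y using additive_subgroup.a_closed[OF I.additive_subgroup_axioms that] by (simp add: ring_on_def)
  have mult: "c * x \<in> I" if "c \<in> OK" "x \<in> I" for x c using I.I_l_closed[OF that(2), of c] that(1) by (simp add: ring_on_def)
  \<comment> \<open>The zero ideal has an infinite quotient, to which \<open>card\<close> assigns 0,
    so \<open>a > 0\<close> excludes it.\<close>
  have ne: "\<exists>x\<in>I. x \<noteq> 0"
  proof (rule ccontr)
    assume "\<not> (\<exists>x\<in>I. x \<noteq> 0)"
    moreover have "0 \<in> I" using additive_subgroup.zero_closed[OF I.additive_subgroup_axioms] by (simp add: ring_on_def)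
    ultimately have "I = {0}" by auto
    hence "inj_on (coset I) OK" by (auto simp: inj_on_def coset_def)
    moreover have "infinite OK"
    proof
      assume "finite OK"
      hence "finite (range (of_int :: int \<Rightarrow> complex))" by (rule finite_subset[rotated]) auto
      hence "finite (UNIV :: int set)" by (rule finite_imageD) (auto simp: inj_def)
      thus False by simp
    qed
    ultimately have "infinite (coset I ` OK)" by (simp add: finite_image_iff)
    hence "Coset.order (ring_on OK Quot I) = 0" by (simp add: order_Quot)
    thus False using I a0 by simp
  qed
  have FI: "FI I" by (rule FI_I[where m = 1]) (use sub add mult ne in auto)
  have "cj ` I = I" using I sub OK_K quad_conj_eq[of I] by auto
  then obtain r n where r: "r > 0" "sqf_divisor n" "I = (\<lambda>x. of_rat r * x) ` ambig n" using stable_ideal_eq[OF FI] by blast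
  obtain t where t: "of_int t + \<omega> \<in> ambig n" using ambig_exists_shift r by blast
  hence "of_rat r * (of_int t + \<omega>) \<in> OK" using r sub by auto
  then obtain i j where "of_rat r * (of_int t + \<omega>) = of_int i + of_int j * \<omega>" using OK_cases by metis
  moreover have "of_rat r * (of_int t + \<omega>) = of_rat (r * of_int t) + of_rat r * \<omega>"
    by (simp add: algebra_simps of_rat_mult)
  \<comment> \<open>Comparing \<omega>-coordinates shows that the rational scaling factor is an
    integer.\<close>
  ultimately have rj: "r = of_int j" unfolding rat_coord int_coord by (simp add: elt_inject)
  have I': "I = (\<lambda>x. of_int j * x) ` ambig n" "j > 0" using r rj by auto
  hence "a = nat (j * n * j)" using index_scaled_ambig[OF r(2) I'(2)] I by simp
  hence aj: "int a = j ^ 2 * n" using I' r(2) by (simp add: sqf_divisor_def power2_eq_square mult_ac)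
  hence "j dvd 1" using assms unfolding sqf_divisor_def squarefree_def by (metis dvd_triv_left)
  hence "j = 1" using I' by simp
  thus "I = ambig (int a)" using I' aj by simp
qed

section \<open>Products of squarefree divisors and of ambiguous ideals\<close>

lemma sqfree_divisor_iff: "sqfree_divisor D a \<longleftrightarrow> sqf_divisor (int a)"
  by (auto simp: sqfree_divisor_def sqf_divisor_def squarefree_int_iff)

text \<open>Removing \<open>gcd a b\<close> from both factors leaves coprime squarefree divisors of
  \<open>D\<close>, whose product \<open>c\<close> represents the square class of
  \<open>a * b\<close>.\<close>

lemma sqf_divisor_product:
  assumes "sqf_divisor a" "sqf_divisor b"
  shows "\<exists>g c. g > 0 \<and> sqf_divisor c \<and> a * b = g ^ 2 * c"
proof -
  define g where "g = gcd a b"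
  have ab: "a > 0" "b > 0" "squarefree a" "squarefree b" "a dvd D" "b dvd D"
    using assms by (auto simp: sqf_divisor_def)
  have g0: "g > 0" using ab by (simp add: g_def)
  obtain a' b' where a': "a = g * a'" "b = g * b'" by (metis g_def dvdE gcd_dvd1 gcd_dvd2)
  have "g * gcd a' b' = g" using g0 a' unfolding g_def
    by (metis abs_gcd_int gcd_mult_distrib_int)
  hence cop: "coprime a' b'" using g0 by (simp add: coprime_iff_gcd_eq_1)
  have "squarefree a'" "squarefree b'" using ab a' squarefree_mono by (metis dvd_triv_right)+
  hence "squarefree (a' * b')" using cop by (simp add: squarefree_mult_coprime)
  moreover have "a' dvd D" "b' dvd D" using ab a' by (metis dvd_mult_right)+
  hence "a' * b' dvd D" using cop by (simp add: divides_mult)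
  moreover have "a' > 0" "b' > 0" using ab a' g0 by (simp_all add: zero_less_mult_iff)
  ultimately have "sqf_divisor (a' * b')" by (simp add: sqf_divisor_def)
  moreover have "a * b = g ^ 2 * (a' * b')" using a' by (simp add: power2_eq_square)
  ultimately show ?thesis using g0 by blast
qed

text \<open>Both sides are conjugation-stable and have the same square.\<close>

lemma ambig_imul:
  assumes "sqf_divisor a" "sqf_divisor b" "sqf_divisor c" "g > 0" "a * b = g ^ 2 * c"
  shows "ambig a \<star> ambig b = principal (of_int g) \<star> ambig c"
proof -
  have FIab: "FI (ambig a)" "FI (ambig b)" using assms FI_ambig by auto
  have pos: "a > 0" "b > 0" "c > 0" using assms by (auto simp: sqf_divisor_def)
  define L where "L = ambig a \<star> ambig b"
  have L: "FI L" unfolding L_def using FIab FI_imul by blast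
  have "cj ` L = L" unfolding L_def using FIab by (simp add: cj_imul FI_subset cj_ambig)
  then obtain r n where r: "r > 0" "sqf_divisor n" "L = (\<lambda>x. of_rat r * x) ` ambig n" using stable_ideal_eq[OF L] by blast
  have n0: "n > 0" using r by (simp add: sqf_divisor_def)
  have Lr: "L = principal (of_rat r) \<star> ambig n" using r by (simp add: principal_imul FI_ambig)
  have "L \<star> L = (ambig a \<star> ambig a) \<star> (ambig b \<star> ambig b)" unfolding L_def by (simp only: imul_ac)
  also have "\<dots> = principal (of_rat (of_int (a * b)))" using assms(1,2) pos by (simp add: ambig_imul_ambig principal_principal of_rat_mult)
  finally have 1: "L \<star> L = principal (of_rat (of_int (a * b)))" .
  have "L \<star> L = principal (of_rat r) \<star> principal (of_rat r) \<star> (ambig n \<star> ambig n)" unfolding Lr by (simp only: imul_ac)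
  also have "\<dots> = principal (of_rat (r ^ 2 * of_int n))"
    using r n0 by (simp add: ambig_imul_ambig principal_principal of_rat_mult power2_eq_square)
  finally have "r ^ 2 * of_int n = of_int (a * b)"
    using 1 pos r(1) n0 by (intro principal_of_rat_inject) auto
  hence eq: "r ^ 2 * of_int n = of_int g ^ 2 * of_int c" using assms(5) by simp
  have "n = c"
  proof (rule squarefree_eq_of_square_ratio)
    show "of_int n = (of_int g / r) ^ 2 * of_int c" using eq r(1) by (simp add: power_divide field_simps)
  qed (use assms r in \<open>auto simp: sqf_divisor_def\<close>)
  hence "r ^ 2 = of_int g ^ 2" using eq pos by simp
  hence "r = of_int g" using r(1) assms(4) by (simp add: power2_eq_iff_nonneg)
  thus ?thesis using Lr \<open>n = c\<close> by (simp add: L_def)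
qed

section \<open>Rational and integral points in terms of norms and generators\<close>

lemma rat_torsor_iff:
  assumes "sqf_divisor (int a)"
  shows "(torsor D a :: (rat \<times> rat) set) \<noteq> {} \<longleftrightarrow> (\<exists>x\<in>K. nm x = of_nat a)"
proof -
  have a0: "a > 0" using assms by (simp add: sqf_divisor_def)
  obtain b where b: "D = int a * b" using assms by (auto simp: sqf_divisor_def)
  hence Db: "D div int a = b" using a0 by simp
  have Dr: "of_int D = (of_nat a * of_int b :: rat)" by (simp add: b)
  show ?thesis
  proof
    assume "(torsor D a :: (rat \<times> rat) set) \<noteq> {}"
    then obtain r s :: rat where rs: "of_nat a * r ^ 2 - of_int b * s ^ 2 = 4" by (auto simp: torsor_def Db)
    have "nm (elt (of_nat a * r / 2) (s / 2)) = of_nat a * (of_nat a * r ^ 2 - of_int b * s ^ 2) / 4"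
      by (simp add: Dr power2_eq_square field_simps)
    hence "nm (elt (of_nat a * r / 2) (s / 2)) = of_nat a" by (simp add: rs)
    thus "\<exists>x\<in>K. nm x = of_nat a" using elt_in_K by blast
  next
    assume "\<exists>x\<in>K. nm x = of_nat a"
    then obtain p q where "nm (elt p q) = of_nat a" by (metis K_cases)
    hence pq: "p ^ 2 - of_nat a * of_int b * q ^ 2 = of_nat a" by (simp add: Dr)
    have "of_nat a * (of_nat a * (2 * p / of_nat a) ^ 2 - of_int b * (2 * q) ^ 2) =
        4 * (p ^ 2 - of_nat a * of_int b * q ^ 2)"
      using a0 by (simp add: power2_eq_square field_simps)
    hence "of_nat a * (2 * p / of_nat a) ^ 2 - of_int b * (2 * q) ^ 2 = 4"
      unfolding pq using a0 by simp
    hence "(2 * p / of_nat a, 2 * q) \<in> torsor D a" by (simp add: torsor_def Db)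
    thus "(torsor D a :: (rat \<times> rat) set) \<noteq> {}" by auto
  qed
qed

lemma int_torsor_iff:
  assumes "sqf_divisor (int a)"
  shows "(torsor D a :: (int \<times> int) set) \<noteq> {} \<longleftrightarrow> (\<exists>x. totally_positive D x \<and> ambig (int a) = principal x)"
proof -
  have a0: "a > 0" using assms by (simp add: sqf_divisor_def)
  obtain b where b: "D = int a * b" using assms by (auto simp: sqf_divisor_def)
  hence Db: "D div int a = b" using a0 by simp
  have Dr: "of_int D = (of_nat a * of_int b :: rat)" by (simp add: b)
  show ?thesis
  proof
    assume "(torsor D a :: (int \<times> int) set) \<noteq> {}"
    then obtain r s :: int where rs: "int a * r ^ 2 - b * s ^ 2 = 4" by (auto simp: torsor_def Db)
    define x where "x = elt (of_nat a * of_int r / 2) (of_int s / 2)"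
    have "nm x = of_nat a * of_int (int a * r ^ 2 - b * s ^ 2) / 4"
      by (simp add: x_def Dr power2_eq_square field_simps)
    hence nmx: "nm x = of_nat a" by (simp add: rs)
    have trx: "tr x = of_int (int a * r)" by (simp add: x_def)
    have xK: "x \<in> K" by (simp add: x_def)
    have x0: "x \<noteq> 0" using nmx a0 by auto
    have xOK: "x \<in> OK" unfolding OK_iff trx nmx using xK by auto
    have xA: "x \<in> ambig (int a)" using xOK nmx unfolding ambig_def by (auto intro!: exI[of _ 1])
    have "ambig (int a) = principal x"
    proof
      show "principal x \<subseteq> ambig (int a)" using ambig_mult[OF _ xA] by (auto simp: principal_def mult.commute)
      show "ambig (int a) \<subseteq> principal x"
      proof
        fix y assume y: "y \<in> ambig (int a)"
        \<comment> \<open>As \<open>a = x * cj x\<close> generates the square of the ideal, the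
          factor \<open>cj x\<close> can be cancelled, leaving \<open>y\<close> in
          \<open>principal x\<close>.\<close>
        have "y * cj x \<in> ambig (int a) \<star> ambig (int a)" using y ambig_cj[OF xA] by (rule imulI)
        hence "y * cj x \<in> principal (of_int (int a))" using ambig_imul_ambig[OF assms] by simp
        then obtain z where z: "z \<in> OK" "y * cj x = of_nat a * z" by (auto simp: principal_def)
        have "of_nat a = x * cj x" using mult_cj[OF xK] nmx by simp
        hence "cj x * y = cj x * (x * z)" using z by (simp add: mult_ac)
        hence "y = x * z" using x0 cj_eq_0_iff[OF xK] by simp
        thus "y \<in> principal x" using z by (auto simp: principal_def)
      qed
    qed
    moreover have "totally_positive D x \<or> totally_positive D (- x)"
      by (rule tp_or_minus) (use xK nmx a0 in auto)
    ultimately show "\<exists>x. totally_positive D x \<and> ambig (int a) = principal x" using principal_minus by metis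
  next
    assume "\<exists>x. totally_positive D x \<and> ambig (int a) = principal x"
    then obtain x where x: "totally_positive D x" "ambig (int a) = principal x" by blast
    have xK: "x \<in> K" "x \<noteq> 0" "nm x > 0" using x tp_K tp_nonzero tp_nm_pos by auto
    have "x * 1 \<in> principal x" unfolding principal_def by (intro imageI) simp
    hence xA: "x \<in> ambig (int a)" using x by simp
    \<comment> \<open>The ideal equals its conjugate, so its square is generated both by
      \<open>a\<close> and by \<open>nm x\<close>. Both are positive, hence equal.\<close>
    have "ambig (int a) \<star> ambig (int a) = principal x \<star> cj ` principal x" using x cj_ambig by metis
    also have "\<dots> = principal (of_rat (nm x))" using xK by (simp add: cj_principal principal_principal cj_eq_0_iff mult_cj)
    finally have "principal (of_rat (nm x)) = principal (of_rat (of_nat a))" using ambig_imul_ambig[OF assms] by simp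
    hence nmx: "nm x = of_nat a" using xK a0 by (intro principal_of_rat_inject) auto
    \<comment> \<open>The point is \<open>(l, j)\<close>: the trace divided by \<open>a\<close> and
      the \<omega>-coordinate, both integers.\<close>
    obtain l where l: "tr x = of_int (int a * l)" using tr_ambig[OF assms xA] by blast
    obtain i j where ij: "x = of_int i + of_int j * \<omega>" using OK_cases ambig_OK xA by metis
    define p where "p = of_int i + of_int j * of_int D / (2 :: rat)"
    have xe: "x = elt p (of_int j / 2)" unfolding ij int_coord p_def ..
    have p: "2 * p = of_nat a * of_int l" using l by (simp add: xe)
    have "4 * nm x = (2 * p) ^ 2 - of_int D * of_int j ^ 2"
      by (simp add: xe power2_eq_square field_simps)
    also have "\<dots> = of_nat a * (of_nat a * of_int l ^ 2 - of_int b * of_int j ^ 2)"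
      unfolding p Dr by (simp add: power2_eq_square algebra_simps)
    finally have "of_nat a * 4 = of_nat a * (of_nat a * of_int l ^ 2 - of_int b * of_int j ^ 2 :: rat)"
      by (simp add: nmx)
    hence "(of_int (int a * l ^ 2 - b * j ^ 2) :: rat) = of_int 4" using a0 by simp
    hence "int a * l ^ 2 - b * j ^ 2 = 4" by (simp only: of_int_eq_iff)
    hence "(l, j) \<in> torsor D a" by (simp add: torsor_def Db)
    thus "(torsor D a :: (int \<times> int) set) \<noteq> {}" by auto
  qed
qed

section \<open>Hilbert 90 and the class of an ambiguous ideal\<close>

lemma FI_sum: assumes "FI I" "FI J" shows "FI {x + y | x y. x \<in> I \<and> y \<in> J}"
proof -
  obtain m where m: "m > 0" "\<And>x. x \<in> I \<Longrightarrow> of_int m * x \<in> OK" using FI_denominator[OF assms(1)] by blast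
  obtain n where n: "n > 0" "\<And>x. x \<in> J \<Longrightarrow> of_int n * x \<in> OK" using FI_denominator[OF assms(2)] by blast
  define M where "M = {x + y | x y. x \<in> I \<and> y \<in> J}"
  have "FI M"
  proof (rule FI_I)
    show "M \<subseteq> K" using assms FI_K by (auto simp: M_def)
    show "s + t \<in> M" if st: "s \<in> M" "t \<in> M" for s t
    proof -
      obtain x y x' y' where xy: "s = x + y" "t = x' + y'" "x \<in> I" "x' \<in> I" "y \<in> J" "y' \<in> J"
        using st by (auto simp: M_def)
      hence "s + t = (x + x') + (y + y')" "x + x' \<in> I" "y + y' \<in> J" using assms FI_add by auto
      thus ?thesis unfolding M_def by blast
    qed
    show "c * s \<in> M" if cs: "c \<in> OK" "s \<in> M" for c s
    proof -
      obtain x y where xy: "s = x + y" "x \<in> I" "y \<in> J" using cs by (auto simp: M_def)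
      hence "c * s = c * x + c * y" "c * x \<in> I" "c * y \<in> J"
        using assms cs FI_mult by (auto simp: distrib_left)
      thus ?thesis unfolding M_def by blast
    qed
    obtain x where "x \<in> I" "x \<noteq> 0" using FI_nonzero assms by blast
    moreover have "x + 0 \<in> M" if "x \<in> I" for x using that FI_0[OF assms(2)] unfolding M_def by blast
    ultimately show "\<exists>x\<in>M. x \<noteq> 0" by force
    show "m * n > 0" using m n by simp
    show "of_int (m * n) * s \<in> OK" if s: "s \<in> M" for s
    proof -
      obtain x y where xy: "s = x + y" "x \<in> I" "y \<in> J" using s by (auto simp: M_def)
      have "of_int (m * n) * s = of_int n * (of_int m * x) + of_int m * (of_int n * y)"
        by (simp add: xy algebra_simps)
      thus ?thesis using m n xy by (auto simp del: of_int_mult)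
    qed
  qed
  thus ?thesis by (simp add: M_def)
qed

text \<open>Hilbert 90 for ideals: an ideal \<open>J\<close> of norm \<open>1\<close> is \<open>B / cj ` B\<close> for \<open>B = OK + J\<close>.\<close>

lemma ideal_norm_one:
  assumes J: "FI J" and one: "J \<star> cj ` J = OK"
  shows "\<exists>B. FI B \<and> J \<star> cj ` B = B"
proof -
  define B where "B = {x + y | x y. x \<in> OK \<and> y \<in> J}"
  have B: "FI B" unfolding B_def by (rule FI_sum[OF FI_OK J])
  have 1: "J \<star> cj ` B \<subseteq> B"
  proof (rule imul_subset)
    fix j z assume jz: "j \<in> J" "z \<in> cj ` B"
    then obtain x y where xy: "x \<in> OK" "y \<in> J" "z = cj (x + y)" by (auto simp: B_def)
    \<comment> \<open>The two summands of \<open>B\<close> are exchanged: \<open>j * cj y\<close>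
      lands in \<open>OK\<close> because \<open>J\<close> has norm 1, and \<open>cj x * j\<close>
      lands in \<open>J\<close>.\<close>
    have "j * z = j * cj y + cj x * j"
      using xy FI_K[OF J] by (simp add: cj_add algebra_simps)
    moreover have "j * cj y \<in> OK" using imulI[of j J "cj y" "cj ` J"] jz xy one by auto
    moreover have "cj x * j \<in> J" using FI_mult[OF J] xy jz by auto
    ultimately show "j * z \<in> B" unfolding B_def by blast
  qed (rule FI_add[OF B])
  have BK: "B \<subseteq> K" and JK: "J \<subseteq> K" using B J FI_subset by auto
  \<comment> \<open>The reverse inclusion follows by conjugating the first one and multiplying by
    \<open>J\<close>, which cancels its own conjugate.\<close>
  have "cj ` (J \<star> cj ` B) \<subseteq> cj ` B" using 1 by (rule image_mono)
  hence "cj ` J \<star> B \<subseteq> cj ` B" using JK BK by (subst (asm) cj_imul) (auto simp: cj_cj_image)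
  hence "J \<star> (cj ` J \<star> B) \<subseteq> J \<star> cj ` B" by (rule imul_mono[OF order_refl])
  moreover have "J \<star> (cj ` J \<star> B) = B" using one B by (simp add: OK_imul flip: imul_assoc)
  ultimately show ?thesis using 1 B by blast
qed

lemma ncl_ambig_in_squares_2torsion:
  assumes a: "sqf_divisor a" and x: "x \<in> K" "nm x = of_int a"
  shows "ncl (ambig a) \<in> squares_2torsion Cl"
proof -
  have a0: "a > 0" using a by (simp add: sqf_divisor_def)
  have FA: "FI (ambig a)" using a by (rule FI_ambig)
  have "totally_positive D x \<or> totally_positive D (- x)" using x a0 by (intro tp_or_minus) auto
  then obtain y where y: "totally_positive D y" "nm y = of_int a" using x by (metis nm_minus)
  have yK: "y \<in> K" "y \<noteq> 0" "inverse y \<noteq> 0" using y tp_K tp_nonzero by auto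
  define J where "J = principal (inverse y) \<star> ambig a"
  have FP: "FI (principal (inverse y))" using yK by (intro FI_principal) auto
  have J: "FI J" unfolding J_def using FP FA by (rule FI_imul)
  have "cj ` J = principal (cj (inverse y)) \<star> ambig a"
    unfolding J_def using FP FA yK by (simp add: cj_imul FI_subset cj_principal cj_ambig)
  hence "J \<star> cj ` J = (principal (inverse y) \<star> principal (cj (inverse y))) \<star> (ambig a \<star> ambig a)"
    unfolding J_def by (simp only: imul_ac)
  also have "principal (inverse y) \<star> principal (cj (inverse y)) = principal (of_rat (inverse (of_int a)))"
    using yK y by (simp add: principal_principal cj_eq_0_iff mult_cj nm_inverse)
  also have "\<dots> \<star> (ambig a \<star> ambig a) = OK"
    using a0 a by (simp add: ambig_imul_ambig principal_principal of_rat_inverse principal_1)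
  finally obtain B where B: "FI B" "J \<star> cj ` B = B" using ideal_norm_one[OF J] by blast
  obtain g where g: "g > 0" "B \<star> cj ` B = principal (of_rat g)" using imul_cj_principal[OF B(1)] by blast
  have "B \<star> B = J \<star> (cj ` B \<star> B)" by (metis B(2) imul_assoc)
  also have "\<dots> = principal (of_rat g) \<star> J" using g by (metis imul_comm)
  finally have "ncl (B \<star> B) = ncl J" using ncl_principal_imul[OF J tp_of_rat[OF g(1)]] by simp
  also have "\<dots> = ncl (ambig a)" unfolding J_def using FA y by (simp add: ncl_principal_imul tp_inverse)
  finally have "ncl (ambig a) = ncl B \<otimes>\<^bsub>Cl\<^esub> ncl B" using B by (simp add: ncl_mult)
  moreover have "ncl B \<in> carrier Cl" using B by (auto simp: carrier_Cl)
  moreover have "ncl (ambig a) \<otimes>\<^bsub>Cl\<^esub> ncl (ambig a) = \<one>\<^bsub>Cl\<^esub>"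
  proof -
    have "FI (principal (of_int a))" using a0 by (intro FI_principal) auto
    moreover have "totally_positive D (of_int a)" using tp_of_rat[of "of_int a"] a0 by simp
    ultimately have "ncl (principal (of_int a)) = \<one>\<^bsub>Cl\<^esub>" using ncl_eq_one_iff by blast
    thus ?thesis using FA a by (simp add: ncl_mult ambig_imul_ambig)
  qed
  ultimately show ?thesis unfolding squares_2torsion_def by blast
qed

text \<open>Hilbert 90 for totally positive elements of norm \<open>1\<close>; for \<open>D < 0\<close> the element \<open>- 1\<close> counts as
  totally positive and needs a separate witness.\<close>

lemma hilbert90:
  assumes c: "totally_positive D c" "nm c = 1"
  shows "\<exists>e. totally_positive D e \<and> e * e = of_rat (nm e) * c"
proof -
  have cK: "c \<in> K" "c * cj c = 1" using c tp_K mult_cj by auto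
  \<comment> \<open>From \<open>c * cj c = 1\<close>, the element \<open>1 + c\<close> satisfies
    \<open>e = c * cj e\<close>. So does \<open>sqrtD\<close> when \<open>c = - 1\<close>, as
    conjugation negates it.\<close>
  define e where "e = (if c = - 1 then sqrtD else 1 + c)"
  have sqrtD: "sqrtD = elt 0 1" by (simp add: elt_def)
  have eK: "e \<in> K" using cK sqrtD by (simp add: e_def)
  have e0: "e \<noteq> 0" by (auto simp: e_def sqrtD elt_eq_0_iff add_eq_0_iff)
  have "e = c * cj e"
    using cK by (auto simp: e_def sqrtD elt_minus cj_add algebra_simps)
  hence "e * e = (e * cj e) * c" by (metis mult.assoc mult.commute)
  hence ee: "e * e = of_rat (nm e) * c" using mult_cj[OF eK] by simp
  have "totally_positive D e" unfolding totally_positive_iff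
  proof (intro conjI impI eK e0)
    assume D: "D > 0"
    have trc: "tr c > 0" using c D by (simp add: totally_positive_iff)
    have "tr (- 1) < 0" by (simp add: one_eq_elt elt_minus)
    hence e: "e = 1 + c" using trc by (auto simp: e_def)
    \<comment> \<open>Uses \<open>nm c = 1\<close> in the expansion \<open>1 + tr c + nm c\<close>
      of the norm of \<open>1 + c\<close>.\<close>
    have "nm e = 2 + tr c" using cK c by (auto simp: e one_eq_elt elt_add power2_eq_square algebra_simps elim!: K_cases)
    thus "nm e > 0" using trc by simp
    have "tr e = 2 + tr c" using cK by (auto simp: e one_eq_elt elt_add algebra_simps elim!: K_cases)
    thus "tr e > 0" using trc by simp
  qed
  thus ?thesis using ee by blast
qed

lemma squares_2torsion_imp_ncl_ambig:
  assumes Z: "Z \<in> squares_2torsion Cl"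
  shows "\<exists>a. sqf_divisor a \<and> (\<exists>x\<in>K. nm x = of_int a) \<and> Z = ncl (ambig a)"
proof -
  from Z obtain B where B: "FI B" "Z = ncl B \<otimes>\<^bsub>Cl\<^esub> ncl B" and ZZ: "Z \<otimes>\<^bsub>Cl\<^esub> Z = \<one>\<^bsub>Cl\<^esub>"
    by (auto simp: squares_2torsion_def carrier_Cl)
  obtain g where g: "g > 0" "B \<star> cj ` B = principal (of_rat g)" using imul_cj_principal[OF B(1)] by blast
  define h where "h = inverse g"
  have h: "h > 0" "h * g = 1" using g by (auto simp: h_def)
  have FBB: "FI (B \<star> B)" using B FI_imul by blast
  have FPh: "FI (principal (of_rat h))" using h by (intro FI_principal) auto
  define J where "J = principal (of_rat h) \<star> (B \<star> B)"
  have J: "FI J" unfolding J_def using FPh FBB by (rule FI_imul)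
  have ZJ: "Z = ncl J" using B ncl_principal_imul[OF FBB tp_of_rat[OF h(1)]] by (simp add: J_def ncl_mult)
  have "cj ` J = principal (of_rat h) \<star> (cj ` B \<star> cj ` B)"
    unfolding J_def using FPh FBB B by (simp add: cj_imul FI_subset cj_principal)
  hence "J \<star> cj ` J = (principal (of_rat h) \<star> (B \<star> cj ` B)) \<star> (principal (of_rat h) \<star> (B \<star> cj ` B))"
    unfolding J_def by (simp only: imul_ac)
  also have "principal (of_rat h) \<star> (B \<star> cj ` B) = OK"
    unfolding g(2) using g h by (simp add: principal_principal principal_1 flip: of_rat_mult)
  finally have JJ: "J \<star> cj ` J = OK" by (simp add: OK_imul FI_OK)
  have "ncl (J \<star> J) = \<one>\<^bsub>Cl\<^esub>" using ZZ J by (simp add: ZJ ncl_mult)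
  then obtain c where c: "totally_positive D c" "J \<star> J = principal c"
    using ncl_eq_one_iff[OF FI_imul[OF J J]] by blast
  have cK: "c \<in> K" "c \<noteq> 0" "nm c > 0" using c tp_K tp_nonzero tp_nm_pos by auto
  \<comment> \<open>The ideal generated by \<open>nm c\<close> is \<open>principal c\<close> times
    its conjugate, that is, the square of \<open>J\<close> times its conjugate, which is
    \<open>OK\<close>. Positivity of \<open>nm c\<close> then gives exactly 1.\<close>
  have "principal (of_rat (nm c)) = principal c \<star> cj ` principal c" using cK by (simp add: cj_principal principal_principal cj_eq_0_iff mult_cj)
  also have "\<dots> = (J \<star> J) \<star> (cj ` J \<star> cj ` J)" using c(2) J by (metis cj_imul FI_subset)
  also have "\<dots> = (J \<star> cj ` J) \<star> (J \<star> cj ` J)" by (simp only: imul_ac)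
  also have "\<dots> = principal (of_rat 1)" by (simp add: JJ OK_imul FI_OK principal_1)
  finally have "nm c = 1" using cK by (intro principal_of_rat_inject) auto
  then obtain e where e: "totally_positive D e" "e * e = of_rat (nm e) * c" using hilbert90 c by blast
  have eK: "e \<in> K" "e \<noteq> 0" "nm e > 0" "inverse e \<noteq> 0" "nm e \<noteq> 0"
    using e(1) tp_K tp_nonzero tp_nm_pos[OF e(1)] by auto
  define I where "I = principal (inverse e) \<star> J"
  have FPe: "FI (principal (inverse e))" using eK by (intro FI_principal) auto
  have I: "FI I" unfolding I_def using FPe J by (rule FI_imul)
  define q where "q = inverse (nm e)"
  have q0: "q > 0" using eK by (simp add: q_def)
  have "I \<star> I = (principal (inverse e) \<star> principal (inverse e)) \<star> (J \<star> J)" unfolding I_def by (simp only: imul_ac)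
  also have "\<dots> = principal (inverse e * inverse e * c)" unfolding c(2) using eK cK by (simp add: principal_principal)
  also have "inverse e * inverse e * c = of_rat q"
    using eK cK(2) unfolding nonzero_inverse_mult_distrib[OF eK(2) eK(2), symmetric] e(2)
    by (simp add: q_def of_rat_inverse)
  finally have II: "I \<star> I = principal (of_rat q)" .
  have "cj ` I = principal (cj (inverse e)) \<star> cj ` J"
    unfolding I_def using FPe J eK by (simp add: cj_imul FI_subset cj_principal)
  hence "I \<star> cj ` I = (principal (inverse e) \<star> principal (cj (inverse e))) \<star> (J \<star> cj ` J)"
    unfolding I_def by (simp only: imul_ac)
  also have "\<dots> = principal (of_rat q)"
    using eK by (simp add: JJ principal_principal cj_eq_0_iff mult_cj nm_inverse q_def imul_OK FI_principal)
  \<comment> \<open>Both products are generated by \<open>1 / nm e\<close>: one since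
    \<open>J\<close> has norm 1, the other since \<open>e * e = nm e * c\<close> and
    \<open>J \<star> J = principal c\<close>. Cancelling \<open>I\<close> gives stability.\<close>
  finally have "I \<star> cj ` I = I \<star> I" using II by simp
  hence "cj ` I = I" using imul_cancel[OF FI_cj[OF I] I I] by blast
  then obtain r a where r: "r > 0" "sqf_divisor a" "I = (\<lambda>x. of_rat r * x) ` ambig a" using stable_ideal_eq[OF I] by blast
  have a0: "a > 0" using r by (simp add: sqf_divisor_def)
  have FA: "FI (ambig a)" using r FI_ambig by blast
  have Ir: "I = principal (of_rat r) \<star> ambig a" using r FA by (simp add: principal_imul)
  have "Z = ncl I" using ZJ ncl_principal_imul[OF J tp_inverse[OF e(1)]] by (simp add: I_def)
  also have "\<dots> = ncl (ambig a)" unfolding Ir using ncl_principal_imul[OF FA tp_of_rat[OF r(1)]] by simp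
  finally have ZA: "Z = ncl (ambig a)" .
  have "I \<star> I = principal (of_rat r) \<star> principal (of_rat r) \<star> (ambig a \<star> ambig a)" unfolding Ir by (simp only: imul_ac)
  also have "\<dots> = principal (of_rat (r ^ 2 * of_int a))"
    using r a0 by (simp add: ambig_imul_ambig principal_principal of_rat_mult power2_eq_square)
  finally have rq: "r ^ 2 * of_int a = q"
    using II r(1) a0 q0 by (intro principal_of_rat_inject) auto
  \<comment> \<open>The witness \<open>1 / (r * e)\<close> is read off from
    \<open>r ^ 2 * a = q = 1 / nm e\<close>.\<close>
  have "nm (of_rat (inverse r) * inverse e) = inverse r ^ 2 * q"
    using eK by (simp add: nm_mult nm_inverse q_def del: inverse_eq_divide)
  also have "\<dots> = of_int a" using r(1) unfolding rq[symmetric] by (simp add: power2_eq_square field_simps)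
  finally have "nm (of_rat (inverse r) * inverse e) = of_int a" .
  thus ?thesis using r(2) ZA eK by (intro exI[of _ a] conjI bexI[of _ "of_rat (inverse r) * inverse e"]) auto
qed

section \<open>The exact sequence\<close>

lemma Sel2_set_eq: "Sel2_set D = {square_class a | a. sqf_divisor (int a) \<and> (\<exists>x\<in>K. nm x = of_nat a)}"
  unfolding Sel2_set_def using rat_torsor_iff sqfree_divisor_iff by blast

lemma W2_set_eq: "W2_set D = {square_class a | a. sqf_divisor (int a) \<and> (\<exists>x. totally_positive D x \<and> ambig (int a) = principal x)}"
  unfolding W2_set_def using int_torsor_iff sqfree_divisor_iff by blast

text \<open>Classes containing a squarefree divisor of \<open>D\<close> contain only one, by
  \<open>square_class_inject\<close>; on other cosets the value is arbitrary.\<close>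

definition cl :: "rat set \<Rightarrow> complex set set" where
  "cl Z = ncl (ambiguous_ideal D (THE a. sqfree_divisor D a \<and> square_class a = Z))"

lemma sqf_divisor_square_class_inject: "sqf_divisor (int a) \<Longrightarrow> sqf_divisor (int b) \<Longrightarrow> square_class a = square_class b \<Longrightarrow> a = b"
  using square_class_inject[of a b] by (auto simp: sqf_divisor_def squarefree_int_iff)

lemma cl_square_class:
  assumes "sqf_divisor (int a)"
  shows "cl (square_class a) = ncl (ambiguous_ideal D a)"
proof -
  have "(THE b. sqfree_divisor D b \<and> square_class b = square_class a) = a"
    using assms sqf_divisor_square_class_inject by (intro the_equality) (auto simp: sqfree_divisor_iff)
  thus ?thesis by (simp add: cl_def)
qed

lemma cl_ambig: "sqf_divisor (int a) \<Longrightarrow> cl (square_class a) = ncl (ambig (int a))"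
  by (simp add: cl_square_class ambiguous_ideal_eq)

lemma square_class_product:
  assumes a: "sqf_divisor (int a)" and b: "sqf_divisor (int b)"
  obtains g c where "g > 0" "sqf_divisor (int c)" "a * b = g ^ 2 * c"
    "square_class a \<otimes>\<^bsub>square_class_group\<^esub> square_class b = square_class c"
proof -
  obtain g' c' where gc: "g' > 0" "sqf_divisor c'" "int a * int b = g' ^ 2 * c'" using sqf_divisor_product[OF a b] by blast
  define g where "g = nat g'"
  define c where "c = nat c'"
  have g': "g' = int g" "c' = int c" using gc by (auto simp: g_def c_def sqf_divisor_def)
  have "int (a * b) = int (g ^ 2 * c)" using gc(3) by (simp add: g')
  hence eq: "a * b = g ^ 2 * c" by (simp only: of_nat_eq_iff)
  have g0: "g > 0" using gc g' by simp
  have "a > 0" "b > 0" using a b by (auto simp: sqf_divisor_def)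
  hence "square_class a \<otimes>\<^bsub>square_class_group\<^esub> square_class b = square_class c"
    using square_class_mult[of a b] square_class_mult_square[OF g0, of c] eq by simp
  thus ?thesis using that[of g c] g0 gc(2) g' eq by simp
qed

lemma sqf_divisor_1: "sqf_divisor 1" by (simp add: sqf_divisor_def)

lemma Sel2_subgroup: "subgroup (Sel2_set D) square_class_group"
proof -
  interpret R: comm_group square_class_group by (rule comm_group_square_classes)
  show ?thesis
  proof (rule R.subgroupI)
    show "Sel2_set D \<subseteq> carrier square_class_group"
      unfolding Sel2_set_eq using square_class_carrier by (auto simp: sqf_divisor_def)
    have "square_class 1 \<in> Sel2_set D" unfolding Sel2_set_eq using sqf_divisor_1
      by (auto intro!: exI[of _ 1] bexI[of _ 1])
    thus "Sel2_set D \<noteq> {}" by auto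
  next
    fix Z assume Z: "Z \<in> Sel2_set D"
    then obtain a where a: "Z = square_class a" "sqf_divisor (int a)" unfolding Sel2_set_eq by auto
    have a0: "a > 0" using a by (simp add: sqf_divisor_def)
    have "Z \<otimes>\<^bsub>square_class_group\<^esub> Z = \<one>\<^bsub>square_class_group\<^esub>"
      using square_class_mult[OF a0 a0] square_class_mult_square[OF a0, of 1] square_class_1
      by (simp add: a power2_eq_square)
    hence "inv\<^bsub>square_class_group\<^esub> Z = Z"
      using square_class_carrier[OF a0] a by (intro R.inv_equality) auto
    thus "inv\<^bsub>square_class_group\<^esub> Z \<in> Sel2_set D" using Z by simp
  next
    fix Z Y assume "Z \<in> Sel2_set D" "Y \<in> Sel2_set D"
    then obtain a x b y where a: "Z = square_class a" "sqf_divisor (int a)" "x \<in> K" "nm x = of_nat a"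
      and b: "Y = square_class b" "sqf_divisor (int b)" "y \<in> K" "nm y = of_nat b"
      unfolding Sel2_set_eq by auto
    obtain g c where gc: "g > 0" "sqf_divisor (int c)" "a * b = g ^ 2 * c"
      "Z \<otimes>\<^bsub>square_class_group\<^esub> Y = square_class c"
      using square_class_product[OF a(2) b(2)] a(1) b(1) by metis
    \<comment> \<open>The product of the two witnesses has norm \<open>a * b = g ^ 2 * c\<close>;
      dividing it by \<open>g\<close> leaves norm \<open>c\<close>.\<close>
    have "nm (x * y * of_rat (inverse (of_nat g))) = of_nat (a * b) / of_nat g ^ 2"
      using a b by (simp add: nm_mult power_inverse divide_inverse)
    also have "\<dots> = of_nat c" unfolding gc(3) using gc(1) by simp
    finally have "\<exists>z\<in>K. nm z = of_nat c" using a b by blast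
    thus "Z \<otimes>\<^bsub>square_class_group\<^esub> Y \<in> Sel2_set D" unfolding Sel2_set_eq gc(4) using gc(2) by blast
  qed
qed

lemma carrier_Sel2: "carrier (Sel2 D) = Sel2_set D"
  and mult_Sel2: "Z \<otimes>\<^bsub>Sel2 D\<^esub> Y = Z \<otimes>\<^bsub>square_class_group\<^esub> Y"
  by (simp_all add: Sel2_def)

lemma carrier_Cl2_2: "carrier (Cl2_2 D) = squares_2torsion Cl"
  and mult_Cl2_2: "Z \<otimes>\<^bsub>Cl2_2 D\<^esub> Y = Z \<otimes>\<^bsub>Cl\<^esub> Y"
  and one_Cl2_2: "\<one>\<^bsub>Cl2_2 D\<^esub> = \<one>\<^bsub>Cl\<^esub>"
  by (simp_all add: Cl2_2_def)

lemma group_Sel2: "group (Sel2 D)"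
  unfolding Sel2_def using Sel2_subgroup comm_group_square_classes
  by (intro subgroup.subgroup_is_group) (simp_all add: comm_group_def)

lemma group_Cl2_2: "group (Cl2_2 D)"
  unfolding Cl2_2_def
  by (intro subgroup.subgroup_is_group squares_2torsion_subgroup CG.comm_group_axioms CG.is_group)

text \<open>Passing from \<open>a * b\<close> to its squarefree part \<open>c\<close> changes the
  ideal by the factor \<open>g > 0\<close>, which is totally positive and so invisible in the narrow
  class group.\<close>

lemma cl_hom: "cl \<in> hom (Sel2 D) (Cl2_2 D)"
proof (rule homI)
  fix Z assume "Z \<in> carrier (Sel2 D)"
  then obtain a x where a: "Z = square_class a" "sqf_divisor (int a)" "x \<in> K" "nm x = of_nat a"
    unfolding carrier_Sel2 Sel2_set_eq by auto
  show "cl Z \<in> carrier (Cl2_2 D)" unfolding carrier_Cl2_2 a(1) cl_ambig[OF a(2)]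
    using ncl_ambig_in_squares_2torsion[OF a(2,3)] a(4) by simp
next
  fix Z Y assume "Z \<in> carrier (Sel2 D)" "Y \<in> carrier (Sel2 D)"
  then obtain a b where a: "Z = square_class a" "sqf_divisor (int a)" and b: "Y = square_class b" "sqf_divisor (int b)"
    unfolding carrier_Sel2 Sel2_set_eq by auto
  obtain g c where gc: "g > 0" "sqf_divisor (int c)" "a * b = g ^ 2 * c"
    "Z \<otimes>\<^bsub>square_class_group\<^esub> Y = square_class c"
    using square_class_product[OF a(2) b(2)] a(1) b(1) by metis
  have "int a * int b = int g ^ 2 * int c" using arg_cong[OF gc(3), of int] by simp
  hence "ambig (int a) \<star> ambig (int b) = principal (of_int (int g)) \<star> ambig (int c)"
    using a b gc by (intro ambig_imul) auto
  moreover have "totally_positive D (of_int (int g))" using tp_of_rat[of "of_nat g"] gc(1) by simp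
  ultimately have "ncl (ambig (int a) \<star> ambig (int b)) = ncl (ambig (int c))"
    using ncl_principal_imul[OF FI_ambig[OF gc(2)]] by simp
  thus "cl (Z \<otimes>\<^bsub>Sel2 D\<^esub> Y) = cl Z \<otimes>\<^bsub>Cl2_2 D\<^esub> cl Y"
    using a b gc by (simp add: mult_Sel2 mult_Cl2_2 cl_ambig ncl_mult FI_ambig)
qed

lemma cl_surj: "cl ` carrier (Sel2 D) = carrier (Cl2_2 D)"
proof
  show "cl ` carrier (Sel2 D) \<subseteq> carrier (Cl2_2 D)" using cl_hom by (auto simp: hom_def)
  show "carrier (Cl2_2 D) \<subseteq> cl ` carrier (Sel2 D)"
  proof
    fix Z assume "Z \<in> carrier (Cl2_2 D)"
    then obtain a where a: "sqf_divisor a" "\<exists>x\<in>K. nm x = of_int a" "Z = ncl (ambig a)"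
      using squares_2torsion_imp_ncl_ambig unfolding carrier_Cl2_2 by blast
    define n where "n = nat a"
    have n: "a = int n" using a(1) by (simp add: n_def sqf_divisor_def)
    have "Z = cl (square_class n)" using a n by (simp add: cl_ambig)
    moreover have "square_class n \<in> Sel2_set D" unfolding Sel2_set_eq using a n by auto
    ultimately show "Z \<in> cl ` carrier (Sel2 D)" by (auto simp: carrier_Sel2)
  qed
qed

lemma cl_kernel: "kernel (Sel2 D) (Cl2_2 D) cl = W2_set D"
proof (rule equalityI; rule subsetI)
  fix Z assume Z: "Z \<in> kernel (Sel2 D) (Cl2_2 D) cl"
  then obtain a where a: "Z = square_class a" "sqf_divisor (int a)"
    unfolding kernel_def carrier_Sel2 Sel2_set_eq by auto
  have "ncl (ambig (int a)) = \<one>\<^bsub>Cl\<^esub>" using Z a by (simp add: kernel_def one_Cl2_2 cl_ambig)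
  thus "Z \<in> W2_set D" unfolding W2_set_eq using a ncl_eq_one_iff[OF FI_ambig[OF a(2)]] by blast
next
  fix Z assume "Z \<in> W2_set D"
  then obtain a x where a: "Z = square_class a" "sqf_divisor (int a)" "totally_positive D x" "ambig (int a) = principal x"
    unfolding W2_set_eq by auto
  \<comment> \<open>Membership in the Selmer group follows by reading an integral point as a
    rational one.\<close>
  have "(torsor D a :: (int \<times> int) set) \<noteq> {}" using int_torsor_iff[OF a(2)] a(3,4) by blast
  then obtain r s :: int where rs: "int a * r ^ 2 - (D div int a) * s ^ 2 = 4" by (auto simp: torsor_def)
  have "of_nat a * of_int r ^ 2 - of_int (D div int a) * of_int s ^ 2 = (4 :: rat)"
    using arg_cong[OF rs, of "of_int :: int \<Rightarrow> rat"] by simp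
  hence "(of_int r, of_int s) \<in> (torsor D a :: (rat \<times> rat) set)" by (simp add: torsor_def)
  hence "Z \<in> Sel2_set D" unfolding Sel2_set_def using a sqfree_divisor_iff by blast
  moreover have "cl Z = \<one>\<^bsub>Cl\<^esub>" using a ncl_eq_one_iff[OF FI_ambig[OF a(2)]] by (auto simp: cl_ambig)
  ultimately show "Z \<in> kernel (Sel2 D) (Cl2_2 D) cl" by (simp add: kernel_def carrier_Sel2 one_Cl2_2)
qed

lemma exact_sequence:
  "short_exact (W2 D) (Sel2 D) (Cl2_2 D) id cl \<and> Sha2 D \<cong> Cl2_2 D"
proof -
  interpret group_hom "Sel2 D" "Cl2_2 D" cl
    using group_Sel2 group_Cl2_2 cl_hom by (simp add: group_hom_def group_hom_axioms_def)
  have W: "subgroup (W2_set D) (Sel2 D)" using subgroup_kernel by (simp add: cl_kernel)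
  have "group (W2 D)" unfolding W2_def using W group_Sel2 by (rule subgroup.subgroup_is_group)
  moreover have "id \<in> mon (W2 D) (Sel2 D)"
    using subgroup.subset[OF W] by (auto simp: mon_def hom_def W2_def)
  moreover have "cl \<in> epi (Sel2 D) (Cl2_2 D)" using cl_hom cl_surj by (simp add: epi_def)
  moreover have "Sha2 D \<cong> Cl2_2 D"
    using FactGroup_iso[OF cl_surj] by (simp add: Sha2_def cl_kernel)
  ultimately show ?thesis using group_Sel2 group_Cl2_2
    by (simp add: short_exact_def cl_kernel) (simp add: W2_def)
qed

end

theorem theorem6p4:
  fixes d D :: int
  assumes "squarefree d" and "d \<noteq> 1" and "D = quad_disc d"
  shows "(\<exists>cl. (\<forall>a. sqfree_divisor D a \<and> square_class a \<in> Sel2_set D \<longrightarrow>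
                    cl (square_class a) = narrow_class D (ambiguous_ideal D a)) \<and>
               short_exact (W2 D) (Sel2 D) (Cl2_2 D) id cl) \<and>
         Sha2 D \<cong> Cl2_2 D"
proof -
  interpret quadratic d D using assms by unfold_locales
  show ?thesis
    using exact_sequence cl_square_class sqfree_divisor_iff by blast
qed

end
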